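(* For every $\epsilon>0$ there is $N_0(\epsilon)$ such that for all $N\ge N_0(\epsilon)$ and all $A,B\subseteq[N]=\{1,\dots,N\}$ with $|A|,|B|\ge(\tfrac38+\epsilon)N$, the sumset $A+B$ contains a perfect square. Quantitatively, $$\#\{(a,b)\in A\times B : a+b\in S\}\ \ge\ 10^{-6}\epsilon^3N^{3/2},$$ where $S=\{m^2:m\in\mathbb{N}\}$ is the set of positive perfect squares. *)

theory Defs
  imports Complex_Main
begin

definition pos_squares :: "nat set" where
  "pos_squares = {m^2 | m::nat. m \<ge> 1}"

end

theory Submission
  imports Defs "HOL-Analysis.Analysis" "HOL-Number_Theory.Number_Theory"
begin

text \<open>
  Weyl differencing shows that \<open>\<Sum>\<^sub>m e(\<theta> m\<^sup>2)\<close> is small unless \<open>\<theta>\<close> is within \<open>O(1/N)\<close> of a rational with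
  bounded denominator. Hence, up to a negligible error, the squares may be replaced by their translates
  \<open>m\<^sup>2 - Q h\<close>, averaged over \<open>h\<close>, for a highly divisible \<open>Q = 2\<^sup>k q\<close> with \<open>q\<close> odd, and it remains to
  bound from below the number of pairs of residues modulo \<open>Q\<close> whose sum is a square.

  Modulo the odd part \<open>q\<close>, the graph joining \<open>u\<close> and \<open>v\<close> when \<open>u + v\<close> is a square is an expander: its
  nontrivial eigenvalues are normalised Gauss sums of size at most \<open>1/\<surd>3\<close>, so sets of density \<open>x\<close>
  and \<open>y\<close> without an edge between them satisfy \<open>x + y + 2xy \<le> 1\<close>. Over an edge the 2-adic fibres of
  \<open>A\<close> and \<open>B\<close>, of measure \<open>a/8\<close> and \<open>b/8\<close>, must themselves avoid squares; since \<open>0, 1, 4\<close> are the squares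
  modulo 8, this forces \<open>a + b \<le> 6\<close> unless one fibre is very small. Feeding the level sets
  \<open>{a > t}\<close> and \<open>{b > 6 - t}\<close> into the expander inequality and integrating over \<open>t\<close> shows that \<open>a\<close> and
  \<open>b\<close> cannot both have mean above 3. Keeping track of the loss gives \<open>\<epsilon>\<^sup>3\<close>: a factor \<open>\<epsilon>\<close> for the
  proportion of edges over which the fibres do meet, and \<open>\<epsilon>\<^sup>2\<close> for the product of two fibre densities.
\<close>

section \<open>Fourier analysis on cyclic groups\<close>

text \<open>The density 3/8 is forced by the modulus 8: {0, 3, 4} and {2, 3, 7} have three classes
  each, and no sum of the two is 0, 1 or 4 modulo 8. So \<open>a + b \<le> 6\<close> has no slack,
  and every other step may only lose quantities of order \<epsilon>. Fibres need not look alike over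
  different residues modulo \<open>q\<close>: they may be full on one set of residues and empty
  elsewhere, and where one fibre is empty nothing modulo 8 restricts the other. Only expansion
  excludes this. An eigenvalue bound \<lambda> limits two edge-free sets of equal density to
  \<lambda>/(1 + \<lambda>), which lies below 3/8 exactly when \<lambda> < 3/5. The worst odd
  modulus, a multiple of 3, gives 1/sqrt 3 = 0.577..., that is density 0.366...; the margin is
  small, so the later constants are tuned to it. The integral over levels becomes a finite sum:
  fibre densities are rounded to integers between 0 and \<open>K\<close>, which turns the analysis
  modulo 8 into integer arithmetic.\<close>

lemma sum_roots_of_unity:
  fixes L :: nat and x :: int
  assumes L: "L > 0"
  shows "(\<Sum>k<L. cis (2*pi*(real k * of_int x / real L))) = (if int L dvd x then of_nat L else 0)"
proof (cases "int L dvd x")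
  case True
  then obtain y where y: "x = int L * y" by auto
  have "cis (2*pi*(real k * of_int x / real L)) = 1" for k :: nat
  proof -
    have "real k * of_int x / real L = of_int (int k * y)" using L by (simp add: y)
    then show ?thesis using cis_multiple_2pi[of "of_int (int k * y)"] by (metis Ints_of_int)
  qed
  then show ?thesis using True by simp
next
  case False
  define w where "w = cis (2*pi*(of_int x / real L))"
  have p: "cis (2*pi*(real k * of_int x / real L)) = w ^ k" for k
    unfolding w_def Complex.DeMoivre by (rule arg_cong[where f = cis]) simp
  have "w \<noteq> 1"
  proof
    assume "w = 1"
    then obtain n :: int where "2*pi*(of_int x / real L) = 2 * pi * of_int n"
      unfolding w_def by (auto simp: complex_eq_iff cos_one_2pi_int)
    then have "of_int x = real_of_int n * real L" using L by (simp add: field_simps)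
    then have "of_int x = (of_int (n * int L) :: real)" by simp
    then have "x = n * int L" by (simp only: of_int_eq_iff)
    then show False using False by simp
  qed
  moreover have "w ^ L = 1"
  proof -
    have "w ^ L = cis (2 * pi * of_int x)" unfolding p[symmetric] using L by simp
    then show ?thesis using cis_multiple_2pi[of "of_int x"] by simp
  qed
  ultimately show ?thesis using False unfolding p by (simp add: geometric_sum)
qed

lemma parseval:
  fixes A :: "nat \<Rightarrow> real"
  assumes L: "L > 0"
  shows "(\<Sum>k<L. (norm (\<Sum>a<L. of_real (A a) * cis (2*pi*(real k * real a / real L))))\<^sup>2) = real L * (\<Sum>a<L. (A a)\<^sup>2)"
proof -
  let ?c = "\<lambda>k a. cis (2*pi*(real k * real a / real L))"
  have "complex_of_real (\<Sum>k<L. (norm (\<Sum>a<L. of_real (A a) * ?c k a))\<^sup>2)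
     = (\<Sum>k<L. (\<Sum>a<L. of_real (A a) * ?c k a) * cnj (\<Sum>a<L. of_real (A a) * ?c k a))"
    by (simp only: of_real_sum complex_norm_square)
  also have "\<dots> = (\<Sum>k<L. \<Sum>a<L. \<Sum>b<L. of_real (A a * A b) * cis (2*pi*(real k * of_int (int a - int b) / real L)))"
  proof -
    have "?c k a * cnj (?c k b) = cis (2*pi*(real k * of_int (int a - int b) / real L))" for k a b
      by (simp add: cis_cnj cis_mult) (simp add: field_simps diff_divide_distrib)
    moreover have "of_real (A a) * ?c k a * cnj (of_real (A b) * ?c k b) = of_real (A a * A b) * (?c k a * cnj (?c k b))" for k a b
      by simp
    ultimately show ?thesis by (simp only: sum_product cnj_sum)
  qed
  also have "\<dots> = (\<Sum>a<L. \<Sum>b<L. of_real (A a * A b) * (\<Sum>k<L. cis (2*pi*(real k * of_int (int a - int b) / real L))))"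
    by (subst sum.swap, rule sum.cong[OF refl], subst sum.swap) (simp add: sum_distrib_left)
  also have "\<dots> = (\<Sum>a<L. \<Sum>b<L. if b = a then of_real (A a * A b) * of_nat L else 0)"
  proof (intro sum.cong refl)
    fix a b assume "a \<in> {..<L}" "b \<in> {..<L}"
    then have "int L dvd int a - int b \<longleftrightarrow> b = a"
      by (auto dest: zdvd_imp_le simp: zdvd_not_zless) (smt (verit) dvd_diff_commute of_nat_0_le_iff of_nat_less_iff zdvd_not_zless of_nat_eq_iff)
    then show "of_real (A a * A b) * (\<Sum>k<L. cis (2*pi*(real k * of_int (int a - int b) / real L)))
       = (if b = a then of_real (A a * A b) * of_nat L else 0)"
      unfolding sum_roots_of_unity[OF L] by simp
  qed
  also have "\<dots> = of_real (real L * (\<Sum>a<L. (A a)\<^sup>2))"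
    by (simp add: sum.delta power2_eq_square sum_distrib_left mult_ac)
  finally show ?thesis by (simp only: of_real_eq_iff)
qed

text \<open>Detecting \<open>a + b = t j\<close> by characters leaves a product of three transforms;
  the kernel is bounded in supremum and the other two by Cauchy-Schwarz and \<open>parseval\<close>.
  In both uses \<open>c\<close> is a difference of two weights, so that a count is compared with a
  model for it. Indexing by \<open>j\<close> rather than by the target lets several \<open>j\<close>
  hit the same residue and be counted with multiplicity.\<close>

lemma bilinear_fourier_bound:
  fixes A B :: "nat \<Rightarrow> real" and c :: "'j \<Rightarrow> real" and t :: "'j \<Rightarrow> int"
  assumes L: "L > 0" and J: "finite J"
    and M: "\<And>k. k < L \<Longrightarrow> norm (\<Sum>j\<in>J. of_real (c j) * cis (2*pi*(real k * of_int (t j) / real L))) \<le> M"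
  shows "\<bar>\<Sum>j\<in>J. c j * (\<Sum>a<L. \<Sum>b<L. if int L dvd int a + int b - t j then A a * B b else 0)\<bar>
     \<le> M * sqrt (\<Sum>a<L. (A a)\<^sup>2) * sqrt (\<Sum>b<L. (B b)\<^sup>2)"
proof -
  let ?e = "\<lambda>x. cis (2*pi*x)"
  define FA where "FA k = (\<Sum>a<L. of_real (A a) * ?e (real k * real a / real L))" for k
  define FB where "FB k = (\<Sum>a<L. of_real (B a) * ?e (real k * real a / real L))" for k
  define FK where "FK k = (\<Sum>j\<in>J. of_real (c j) * ?e (- (real k * of_int (t j) / real L)))" for k
  have FK: "norm (FK k) \<le> M" if "k < L" for k
  proof -
    have "FK k = cnj (\<Sum>j\<in>J. of_real (c j) * ?e (real k * of_int (t j) / real L))"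
      by (simp add: FK_def cis_cnj cis_inverse)
    then show ?thesis using M[OF that] by (simp only: complex_mod_cnj)
  qed
  have M0: "0 \<le> M" using M[OF L] norm_ge_zero order_trans by blast
  let ?X = "\<Sum>j\<in>J. c j * (\<Sum>a<L. \<Sum>b<L. if int L dvd int a + int b - t j then A a * B b else 0)"
  have "complex_of_real (real L * ?X) = (\<Sum>j\<in>J. \<Sum>a<L. \<Sum>b<L. of_real (c j * A a * B b) * (if int L dvd int a + int b - t j then of_nat L else 0))"
    by (simp add: sum_distrib_left if_distrib mult_ac cong: if_cong)
  also have "\<dots> = (\<Sum>j\<in>J. \<Sum>a<L. \<Sum>b<L. \<Sum>k<L. of_real (c j * A a * B b) * ?e (real k * of_int (int a + int b - t j) / real L))"
    unfolding sum_roots_of_unity[OF L, symmetric] by (simp add: sum_distrib_left)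
  also have "\<dots> = (\<Sum>j\<in>J. \<Sum>a<L. \<Sum>b<L. \<Sum>k<L. (of_real (c j) * ?e (- (real k * of_int (t j) / real L))) *
     ((of_real (A a) * ?e (real k * real a / real L)) * (of_real (B b) * ?e (real k * real b / real L))))"
  proof (intro sum.cong refl)
    fix j a b k
    have "?e (real k * of_int (int a + int b - t j) / real L) = 
      ?e (- (real k * of_int (t j) / real L)) * (?e (real k * real a / real L) * ?e (real k * real b / real L))"
      by (simp add: cis_mult) (simp add: field_simps diff_divide_distrib add_divide_distrib)
    then show "of_real (c j * A a * B b) * ?e (real k * of_int (int a + int b - t j) / real L) = (of_real (c j) * ?e (- (real k * of_int (t j) / real L))) *
     ((of_real (A a) * ?e (real k * real a / real L)) * (of_real (B b) * ?e (real k * real b / real L)))"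
      by (simp add: mult_ac)
  qed
  also have "\<dots> = (\<Sum>j\<in>J. \<Sum>a<L. \<Sum>k<L. \<Sum>b<L. (of_real (c j) * ?e (- (real k * of_int (t j) / real L))) *
     ((of_real (A a) * ?e (real k * real a / real L)) * (of_real (B b) * ?e (real k * real b / real L))))"
    by (rule sum.cong[OF refl], rule sum.cong[OF refl], rule sum.swap)
  also have "\<dots> = (\<Sum>j\<in>J. \<Sum>k<L. \<Sum>a<L. \<Sum>b<L. (of_real (c j) * ?e (- (real k * of_int (t j) / real L))) *
     ((of_real (A a) * ?e (real k * real a / real L)) * (of_real (B b) * ?e (real k * real b / real L))))"
    by (rule sum.cong[OF refl], rule sum.swap)
  also have "\<dots> = (\<Sum>k<L. \<Sum>j\<in>J. \<Sum>a<L. \<Sum>b<L. (of_real (c j) * ?e (- (real k * of_int (t j) / real L))) *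
     ((of_real (A a) * ?e (real k * real a / real L)) * (of_real (B b) * ?e (real k * real b / real L))))"
    by (rule sum.swap)
  also have "\<dots> = (\<Sum>k<L. FK k * (FA k * FB k))"
  proof (rule sum.cong[OF refl])
    fix k
    show "(\<Sum>j\<in>J. \<Sum>a<L. \<Sum>b<L. (of_real (c j) * ?e (- (real k * of_int (t j) / real L))) *
     ((of_real (A a) * ?e (real k * real a / real L)) * (of_real (B b) * ?e (real k * real b / real L)))) = FK k * (FA k * FB k)"
      unfolding FA_def FB_def sum_product FK_def by (simp only: sum_distrib_left)
  qed
  finally have eq: "complex_of_real (real L * ?X) = (\<Sum>k<L. FK k * (FA k * FB k))" .
  have "real L * \<bar>?X\<bar> = norm (complex_of_real (real L * ?X))"
    by (simp only: norm_of_real abs_mult abs_of_nat)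
  also have "\<dots> = norm (\<Sum>k<L. FK k * (FA k * FB k))" by (simp only: eq)
  also have "\<dots> \<le> (\<Sum>k<L. norm (FK k * (FA k * FB k)))" by (rule norm_sum)
  also have "\<dots> \<le> (\<Sum>k<L. M * (norm (FA k) * norm (FB k)))"
    by (rule sum_mono) (auto simp: norm_mult intro!: mult_right_mono FK)
  also have "\<dots> = M * (\<Sum>k<L. \<bar>norm (FA k)\<bar> * \<bar>norm (FB k)\<bar>)" by (simp add: sum_distrib_left)
  also have "\<dots> \<le> M * (L2_set (\<lambda>k. norm (FA k)) {..<L} * L2_set (\<lambda>k. norm (FB k)) {..<L})"
    by (intro mult_left_mono L2_set_mult_ineq M0)
  also have "\<dots> = M * (sqrt (real L * (\<Sum>a<L. (A a)\<^sup>2)) * sqrt (real L * (\<Sum>a<L. (B a)\<^sup>2)))"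
    unfolding L2_set_def FA_def FB_def parseval[OF L] ..
  also have "\<dots> = real L * (M * sqrt (\<Sum>a<L. (A a)\<^sup>2) * sqrt (\<Sum>b<L. (B b)\<^sup>2))"
    by (simp add: real_sqrt_mult mult_ac)
  finally show ?thesis using L by simp
qed

section \<open>Expansion of the square graph modulo an odd number\<close>

text \<open>Counting roots instead of asking whether one exists makes the graph regular: every row
  sum equals \<open>q\<close> (\<open>sum_sqrt_count\<close>), and the eigenvalues are exactly Gauss
  sums, also for composite \<open>q\<close>.\<close>

definition sqrt_count :: "nat \<Rightarrow> nat \<Rightarrow> nat" where
  "sqrt_count q n = card {m. m < q \<and> [m\<^sup>2 = n] (mod q)}"

lemma cis_2pi_cong:
  fixes q :: nat and x y :: int
  assumes "q > 0" "[x = y] (mod int q)"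
  shows "cis (2*pi*(real k * of_int x / real q)) = cis (2*pi*(real k * of_int y / real q))"
proof -
  obtain z where z: "x = y + int q * z" using assms(2) by (metis cong_iff_lin cong_sym)
  have "cis (2*pi*(real k * of_int x / real q)) = cis (2*pi*(real k * of_int y / real q)) * cis (2 * pi * of_int (int k * z))"
    using assms(1) unfolding cis_mult z by (intro arg_cong[where f = cis]) (simp add: field_simps)
  also have "cis (2 * pi * of_int (int k * z)) = 1" by (intro cis_multiple_2pi Ints_of_int)
  finally show ?thesis by simp
qed

lemma sum_mod_shift:
  fixes f :: "nat \<Rightarrow> 'a::comm_monoid_add"
  assumes q: "q > 0" and f: "\<And>i. f (i mod q) = f i"
  shows "(\<Sum>h<q. f (m + h)) = (\<Sum>h<q. f h)"
proof -
  have "bij_betw (\<lambda>h. (m + h) mod q) {..<q} {..<q}"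
  proof (rule bij_betw_imageI)
    show inj: "inj_on (\<lambda>h. (m + h) mod q) {..<q}"
      by (rule inj_onI) (metis cong_add_lcancel_nat cong_def cong_less_modulus_unique_nat lessThan_iff)
    show "(\<lambda>h. (m + h) mod q) ` {..<q} = {..<q}"
      by (rule endo_inj_surj[OF _ _ inj]) (use q in auto)
  qed
  from sum.reindex_bij_betw[OF this, of f] show ?thesis by (simp add: f)
qed

text \<open>Squaring and shifting by \<open>h\<close> leaves \<open>q\<close> times the number of
  \<open>h\<close> with \<open>q\<close> dividing \<open>2 * h * k\<close>. As \<open>q\<close> is
  odd the 2 drops out, and there are gcd(k, q) such \<open>h\<close>. This is a proper divisor of an
  odd number, so its cofactor is at least 3. The bound must hold for composite \<open>q\<close>,
  since \<open>q\<close> will be the odd part of a factorial.\<close>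

lemma gauss_sum_bound:
  fixes q k :: nat
  assumes q: "odd q" and k: "0 < k" "k < q"
  shows "norm (\<Sum>m<q. cis (2*pi*(real k * of_int (int (m\<^sup>2)) / real q))) \<le> real q / sqrt 3"
proof -
  have q0: "q > 0" using k by simp
  define e where "e x = cis (2*pi*(real k * of_int x / real q))" for x :: int
  have e_add: "e (x + y) = e x * e y" for x y
    unfolding e_def cis_mult by (intro arg_cong[where f = cis]) (simp add: algebra_simps add_divide_distrib)
  have e_cnj: "cnj (e x) = e (- x)" for x unfolding e_def cis_cnj by simp
  let ?G = "\<Sum>m<q. e (int (m\<^sup>2))"
  have "complex_of_real ((norm ?G)\<^sup>2) = (\<Sum>m<q. ?G * cnj (e (int (m\<^sup>2))))"
    by (simp only: complex_norm_square cnj_sum sum_distrib_left)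
  also have "\<dots> = (\<Sum>m<q. \<Sum>h<q. e (int (h\<^sup>2)) * e (2 * int h * int m))"
  proof (rule sum.cong[OF refl])
    fix m
    have "?G = (\<Sum>h<q. e (int ((m+h)\<^sup>2)))"
    proof (rule sum_mod_shift[symmetric, OF q0, where f = "\<lambda>i. e (int (i\<^sup>2))"])
      fix i
      have "[int ((i mod q)\<^sup>2) = int (i\<^sup>2)] (mod int q)"
        unfolding cong_int_iff by (simp add: cong_def power_mod)
      then show "e (int ((i mod q)\<^sup>2)) = e (int (i\<^sup>2))" unfolding e_def by (rule cis_2pi_cong[OF q0])
    qed
    also have "\<dots> * cnj (e (int (m\<^sup>2))) = (\<Sum>h<q. e (int (h\<^sup>2)) * e (2 * int h * int m))"
      unfolding sum_distrib_right e_cnj e_add[symmetric]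
      by (intro sum.cong refl arg_cong[where f = e]) (simp add: power2_eq_square algebra_simps)
    finally show "?G * cnj (e (int (m\<^sup>2))) = (\<Sum>h<q. e (int (h\<^sup>2)) * e (2 * int h * int m))" .
  qed
  also have "\<dots> = (\<Sum>h<q. e (int (h\<^sup>2)) * (\<Sum>m<q. e (2 * int h * int m)))"
    by (subst sum.swap) (simp add: sum_distrib_left)
  also have "\<dots> = (\<Sum>h<q. e (int (h\<^sup>2)) * (if int q dvd 2 * int h * int k then of_nat q else 0))"
  proof (intro sum.cong refl arg_cong2[where f = "(*)"])
    fix h
    have "(\<Sum>m<q. e (2 * int h * int m)) = (\<Sum>m<q. cis (2*pi*(real m * of_int (2 * int h * int k) / real q)))"
      unfolding e_def by (intro sum.cong refl arg_cong[where f = cis]) simp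
    then show "(\<Sum>m<q. e (2 * int h * int m)) = (if int q dvd 2 * int h * int k then of_nat q else 0)"
      unfolding sum_roots_of_unity[OF q0] .
  qed
  finally have G: "complex_of_real ((norm ?G)\<^sup>2) = (\<Sum>h<q. e (int (h\<^sup>2)) * (if int q dvd 2 * int h * int k then of_nat q else 0))" .
  define D where "D = {h. h < q \<and> q dvd h * k}"
  have "(norm ?G)\<^sup>2 = norm (complex_of_real ((norm ?G)\<^sup>2))" by (simp del: of_real_power)
  also have "\<dots> \<le> (\<Sum>h<q. norm (e (int (h\<^sup>2)) * (if int q dvd 2 * int h * int k then of_nat q else 0)))"
    unfolding G by (rule norm_sum)
  also have "\<dots> = (\<Sum>h<q. if h \<in> D then real q else 0)"
  proof (intro sum.cong refl)
    fix h assume "h \<in> {..<q}"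
    have "int q dvd 2 * int h * int k \<longleftrightarrow> q dvd 2 * (h * k)"
      by (metis int_dvd_int_iff mult.assoc of_nat_mult of_nat_numeral)
    also have "\<dots> \<longleftrightarrow> q dvd h * k" using q by (simp add: coprime_dvd_mult_right_iff)
    finally show "norm (e (int (h\<^sup>2)) * (if int q dvd 2 * int h * int k then of_nat q else 0)) = (if h \<in> D then real q else 0)"
      using \<open>h \<in> {..<q}\<close> by (auto simp: D_def e_def norm_mult)
  qed
  also have "\<dots> = real q * real (card D)"
  proof -
    have "{..<q} \<inter> D = D" by (auto simp: D_def)
    then show ?thesis by (simp add: sum.If_cases)
  qed
  also have "\<dots> \<le> real q * (real q / 3)"
  proof -
    define g where "g = gcd k q"
    define r where "r = q div g"
    have qr: "q = g * r" by (simp add: g_def r_def)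
    have "g \<le> k" unfolding g_def using k by (simp add: gcd_le1_nat)
    then have "g < q" using k by simp
    then have "r \<noteq> 1" using qr by auto
    moreover have "odd r" using q qr by auto
    ultimately have r3: "r \<ge> 3" by (metis One_nat_def Suc_leI dvd_0_right even_numeral nat_less_le not_less numeral_2_eq_2 numeral_3_eq_3 less_Suc_eq not_less_eq_eq odd_pos)
    have "D \<subseteq> (\<lambda>j. r * j) ` {..<g}"
    proof
      fix h assume h: "h \<in> D"
      have "r dvd h"
      proof -
        obtain k' where k': "k = g * k'" "coprime k' r"
          using gcd_coprime_exists[of k q] k qr
          by (metis g_def gcd_coprime dvd_div_mult_self gcd_dvd1 gcd_eq_0_iff mult.commute r_def less_not_refl)
        have "g * r dvd g * (h * k')" using h by (simp add: D_def qr[symmetric] k'(1) mult_ac)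
        then have "r dvd h * k'" using qr q0 by simp
        then show ?thesis using k'(2) by (metis coprime_commute coprime_dvd_mult_left_iff)
      qed
      then obtain j where j: "h = r * j" by auto
      have "h < q" using h by (simp add: D_def)
      then have "j < g" using j qr by (simp add: mult.commute)
      then show "h \<in> (\<lambda>j. r * j) ` {..<g}" using j by auto
    qed
    then have "card D \<le> g" by (metis card_image_le card_lessThan card_mono finite_imageI finite_lessThan order_trans)
    then have "3 * card D \<le> q" using qr r3 by (metis mult.commute mult_le_mono)
    then have "real (card D) \<le> real q / 3" by simp
    then show ?thesis by (intro mult_left_mono) auto
  qed
  finally have "(norm ?G)\<^sup>2 \<le> (real q / sqrt 3)\<^sup>2" by (simp add: power2_eq_square field_simps)
  then show ?thesis unfolding e_def by (rule power2_le_imp_le) simp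
qed

lemma sum_square_residue_delta:
  fixes q n :: nat
  shows "(\<Sum>m<q. if int q dvd int n - int (m\<^sup>2) then c else (0::real)) = real (sqrt_count q n) * c"
proof -
  have "{..<q} \<inter> {m. int q dvd int n - int (m\<^sup>2)} = {m. m < q \<and> [m\<^sup>2 = n] (mod q)}"
    by (auto simp: cong_iff_dvd_diff dvd_diff_commute simp flip: cong_int_iff)
  then show ?thesis by (simp add: sum.If_cases sqrt_count_def)
qed

lemma sum_residue_delta:
  fixes q :: nat and n :: int
  assumes q: "q > 0"
  shows "(\<Sum>m<q. if int q dvd n - int m then c else (0::real)) = c"
proof -
  have "{..<q} \<inter> {m. int q dvd n - int m} = {nat (n mod int q)}"
  proof (intro equalityI subsetI)
    fix m assume "m \<in> {..<q} \<inter> {m. int q dvd n - int m}"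
    then have "n mod int q = int m" by (auto simp: mod_eq_dvd_iff[symmetric] )
    then show "m \<in> {nat (n mod int q)}" by simp
  next
    fix m assume "m \<in> {nat (n mod int q)}"
    then have "int m = n mod int q" using q by simp
    moreover have "n mod int q < int q" using q by simp
    ultimately have "m < q" "int q dvd n - int m" by (auto simp: minus_mod_eq_mult_div)
    then show "m \<in> {..<q} \<inter> {m. int q dvd n - int m}" by simp
  qed
  then show ?thesis by (simp add: sum.If_cases)
qed

lemma sqrt_count_mod: "sqrt_count q (n mod q) = sqrt_count q n"
  by (simp add: sqrt_count_def cong_def)

lemma sum_sqrt_count:
  assumes q: "q > 0"
  shows "(\<Sum>a<q. real (sqrt_count q (b + a))) = real q"
proof -
  have "(\<Sum>a<q. real (sqrt_count q (b + a))) = (\<Sum>a<q. real (sqrt_count q a))"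
    by (rule sum_mod_shift[OF q]) (simp add: sqrt_count_mod)
  also have "\<dots> = (\<Sum>a<q. \<Sum>m<q. if int q dvd int a - int (m\<^sup>2) then 1 else 0)"
    by (simp only: sum_square_residue_delta mult_1_right)
  also have "\<dots> = (\<Sum>m<q. \<Sum>a<q. if int q dvd int (m\<^sup>2) - int a then 1 else 0)"
    by (subst sum.swap) (simp add: dvd_diff_commute)
  also have "\<dots> = real q" using sum_residue_delta[OF q] by simp
  finally show ?thesis .
qed

lemma sum_eq_sum_indicator:
  fixes f :: "nat \<Rightarrow> real"
  assumes "U \<subseteq> {..<n}"
  shows "(\<Sum>a\<in>U. f a) = (\<Sum>a<n. indicator U a * f a)"
proof -
  have "(\<Sum>a<n. indicator U a * f a) = (\<Sum>a<n. if a \<in> U then f a else 0)"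
    by (intro sum.cong refl) (auto simp: indicator_def)
  also have "\<dots> = (\<Sum>a\<in>{..<n} \<inter> U. f a)" by (simp add: sum.inter_restrict)
  finally show ?thesis using assms by (simp add: Int_absorb1)
qed

text \<open>This is the expander mixing inequality with eigenvalue bound 1/sqrt 3:
  \<open>x * y - \<tau> \<le> sqrt (x * (1 - x) * (y * (1 - y)) / 3)\<close>. Squaring, dropping
  \<tau>^2 and cancelling the common factor \<open>x * y\<close> gives
  \<open>x * y - 2 * \<tau> \<le> (1 - x) * (1 - y) / 3\<close>, which is the claim multiplied out.
  If \<open>x * y \<le> \<tau>\<close> the claim follows already from
  \<open>(1 - x) * (1 - y) \<ge> 0\<close>.\<close>

lemma spectral_bound:
  fixes q :: nat and U V :: "nat set" and \<tau> :: real
  assumes q: "odd q" and U: "U \<subseteq> {..<q}" and V: "V \<subseteq> {..<q}"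
    and E: "(\<Sum>u\<in>U. \<Sum>v\<in>V. real (sqrt_count q (u + v))) \<le> \<tau> * (real q)\<^sup>2" and \<tau>: "\<tau> \<ge> 0"
  defines "x \<equiv> real (card U) / real q" and "y \<equiv> real (card V) / real q"
  shows "x + y + 2 * x * y \<le> 1 + 6 * \<tau>"
proof -
  have q0: "q > 0" using q by (simp add: odd_pos)
  have card: "card U \<le> q" "card V \<le> q" using U V by (metis card_lessThan card_mono finite_lessThan)+
  have xy: "0 \<le> x" "x \<le> 1" "0 \<le> y" "y \<le> 1" using card q0 by (auto simp: x_def y_def)
  define A where "A a = (indicator U a - x :: real)" for a
  define B where "B a = (indicator V a - y :: real)" for a
  have cU: "(\<Sum>a<q. indicator U a) = real q * x" and cV: "(\<Sum>a<q. indicator V a) = real q * y"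
    using U V q0 by (simp_all add: indicator_def sum.If_cases x_def y_def Int_absorb1)
  have sA: "(\<Sum>a<q. A a) = 0" and sB: "(\<Sum>a<q. B a) = 0"
    unfolding A_def B_def sum_subtractf cU cV by simp_all
  have i2: "(indicator W a :: real)\<^sup>2 = indicator W a" for W and a :: nat by (simp add: indicator_def)
  have nA: "(\<Sum>a<q. (A a)\<^sup>2) = real q * (x * (1 - x))"
    unfolding A_def power2_diff i2 sum.distrib sum_subtractf
    by (simp add: cU sum_distrib_left[symmetric] sum_distrib_right[symmetric]) (simp add: algebra_simps power2_eq_square)
  have nB: "(\<Sum>a<q. (B a)\<^sup>2) = real q * (y * (1 - y))"
    unfolding B_def power2_diff i2 sum.distrib sum_subtractf
    by (simp add: cV sum_distrib_left[symmetric] sum_distrib_right[symmetric]) (simp add: algebra_simps power2_eq_square)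
  \<comment> \<open>Squares get weight +1 and a second copy, all residues, weight -1. The copies
    cancel at frequency 0, and elsewhere the second transform vanishes, so one bound
    \<open>real q / sqrt 3\<close> serves every frequency.\<close>
  define J where "J = {..<q} \<times> (UNIV :: bool set)"
  define c where "c j = (if snd j then 1 else -1 :: real)" for j :: "nat \<times> bool"
  define t where "t j = (if snd j then int ((fst j)\<^sup>2) else int (fst j))" for j :: "nat \<times> bool"
  have sumJ: "(\<Sum>j\<in>J. f j) = (\<Sum>m<q. f (m, True)) + (\<Sum>m<q. f (m, False))" for f :: "nat \<times> bool \<Rightarrow> 'z::comm_monoid_add"
  proof -
    have "(\<Sum>j\<in>J. f j) = (\<Sum>m<q. \<Sum>b\<in>UNIV. f (m, b))" unfolding J_def sum.cartesian_product by simp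
    then show ?thesis by (simp add: UNIV_bool sum.distrib add.commute)
  qed
  have "\<bar>\<Sum>j\<in>J. c j * (\<Sum>a<q. \<Sum>b<q. if int q dvd int a + int b - t j then A a * B b else 0)\<bar>
     \<le> (real q / sqrt 3) * sqrt (\<Sum>a<q. (A a)\<^sup>2) * sqrt (\<Sum>b<q. (B b)\<^sup>2)"
  proof (rule bilinear_fourier_bound[OF q0])
    show "finite J" by (simp add: J_def)
    fix k assume k: "k < q"
    have lin: "(\<Sum>m<q. cis (2*pi*(real k * of_int (int m) / real q))) = (if int q dvd int k then of_nat q else 0)"
      using sum_roots_of_unity[OF q0, of "int k"] by (simp add: mult.commute)
    have eq: "(\<Sum>j\<in>J. of_real (c j) * cis (2*pi*(real k * of_int (t j) / real q)))
      = (\<Sum>m<q. cis (2*pi*(real k * of_int (int (m\<^sup>2)) / real q))) - (\<Sum>m<q. cis (2*pi*(real k * of_int (int m) / real q)))"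
      unfolding sumJ c_def t_def by (simp add: sum_negf)
    show "norm (\<Sum>j\<in>J. of_real (c j) * cis (2*pi*(real k * of_int (t j) / real q))) \<le> real q / sqrt 3"
    proof (cases "k = 0")
      case True then show ?thesis unfolding eq by simp
    next
      case False
      then have "\<not> int q dvd int k" using k by (auto dest: dvd_imp_le)
      then show ?thesis unfolding eq lin using gauss_sum_bound[OF q _ k] False by simp
    qed
  qed
  also have "(\<Sum>j\<in>J. c j * (\<Sum>a<q. \<Sum>b<q. if int q dvd int a + int b - t j then A a * B b else 0))
    = (\<Sum>a<q. \<Sum>b<q. real (sqrt_count q (a + b)) * (A a * B b)) - (\<Sum>a<q. A a) * (\<Sum>b<q. B b)"
  proof -
    have swap: "(\<Sum>m<q. \<Sum>a<q. \<Sum>b<q. f m a b) = (\<Sum>a<q. \<Sum>b<q. \<Sum>m<q. f m a b)" for f :: "nat \<Rightarrow> nat \<Rightarrow> nat \<Rightarrow> real"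
      by (subst sum.swap, rule sum.cong[OF refl], rule sum.swap)
    have 1: "(\<Sum>m<q. if int q dvd int a + int b - int (m\<^sup>2) then A a * B b else 0) = real (sqrt_count q (a + b)) * (A a * B b)" for a b
      using sum_square_residue_delta[of q "a + b"] by simp
    have 2: "(\<Sum>m<q. if int q dvd int a + int b - int m then A a * B b else 0) = A a * B b" for a b
      using sum_residue_delta[OF q0, of "int a + int b"] by simp
    show ?thesis unfolding sumJ c_def t_def fst_conv snd_conv
      by (simp add: sum_negf swap 1 2 sum_product del: of_nat_power)
  qed
  also have "(\<Sum>a<q. \<Sum>b<q. real (sqrt_count q (a + b)) * (A a * B b)) =
    (\<Sum>a<q. \<Sum>b<q. real (sqrt_count q (a + b)) * (indicator U a * indicator V b)) - x * y * (real q)\<^sup>2"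
  proof -
    have 1: "(\<Sum>b<q. real (sqrt_count q (a + b))) = real q" for a by (rule sum_sqrt_count[OF q0])
    have 2: "(\<Sum>a<q. real (sqrt_count q (a + b))) = real q" for b
      using sum_sqrt_count[OF q0, of b] by (simp add: add.commute)
    have "(\<Sum>a<q. \<Sum>b<q. real (sqrt_count q (a + b)) * indicator U a) = (\<Sum>a<q. indicator U a * real q)"
    proof (intro sum.cong refl)
      fix a show "(\<Sum>b<q. real (sqrt_count q (a + b)) * indicator U a) = indicator U a * real q"
        unfolding sum_distrib_right[symmetric] 1 by (rule mult.commute)
    qed
    then have 3: "(\<Sum>a<q. \<Sum>b<q. real (sqrt_count q (a + b)) * indicator U a) = x * (real q)\<^sup>2"
      by (simp add: sum_distrib_right[symmetric] cU power2_eq_square)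
    have "(\<Sum>a<q. \<Sum>b<q. real (sqrt_count q (a + b)) * indicator V b) = (\<Sum>b<q. indicator V b * real q)"
    proof (subst sum.swap, intro sum.cong refl)
      fix b show "(\<Sum>a<q. real (sqrt_count q (a + b)) * indicator V b) = indicator V b * real q"
        unfolding sum_distrib_right[symmetric] 2 by (rule mult.commute)
    qed
    then have 4: "(\<Sum>a<q. \<Sum>b<q. real (sqrt_count q (a + b)) * indicator V b) = y * (real q)\<^sup>2"
      by (simp add: sum_distrib_right[symmetric] cV power2_eq_square)
    have 5: "(\<Sum>a<q. \<Sum>b<q. real (sqrt_count q (a + b))) = (real q)\<^sup>2" by (simp add: 1 power2_eq_square)
    have "(\<Sum>a<q. \<Sum>b<q. real (sqrt_count q (a + b)) * (A a * B b)) =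
      (\<Sum>a<q. \<Sum>b<q. real (sqrt_count q (a + b)) * (indicator U a * indicator V b))
      - y * (\<Sum>a<q. \<Sum>b<q. real (sqrt_count q (a + b)) * indicator U a)
      - x * (\<Sum>a<q. \<Sum>b<q. real (sqrt_count q (a + b)) * indicator V b)
      + x * y * (\<Sum>a<q. \<Sum>b<q. real (sqrt_count q (a + b)))"
      unfolding A_def B_def sum_distrib_left sum.distrib[symmetric] sum_subtractf[symmetric]
      by (intro sum.cong refl) (simp add: algebra_simps)
    then show ?thesis unfolding 3 4 5 by (simp add: algebra_simps)
  qed
  also have "(\<Sum>a<q. \<Sum>b<q. real (sqrt_count q (a + b)) * (indicator U a * indicator V b)) = (\<Sum>u\<in>U. \<Sum>v\<in>V. real (sqrt_count q (u + v)))"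
  proof -
    have "(\<Sum>u\<in>U. \<Sum>v\<in>V. real (sqrt_count q (u + v))) = (\<Sum>a<q. indicator U a * (\<Sum>b<q. indicator V b * real (sqrt_count q (a + b))))"
      by (simp only: sum_eq_sum_indicator[OF U] sum_eq_sum_indicator[OF V])
    then show ?thesis by (simp only: sum_distrib_left mult_ac)
  qed
  finally have "x * y * (real q)\<^sup>2 - (\<Sum>u\<in>U. \<Sum>v\<in>V. real (sqrt_count q (u + v))) \<le> (real q / sqrt 3) * sqrt (real q * (x * (1 - x))) * sqrt (real q * (y * (1 - y)))"
    unfolding sA nA nB by simp
  also have "\<dots> = (real q)\<^sup>2 * sqrt (x * (1 - x) * (y * (1 - y)) / 3)"
    by (simp add: real_sqrt_mult real_sqrt_divide power2_eq_square)
  finally have "x * y * (real q)\<^sup>2 - \<tau> * (real q)\<^sup>2 \<le> (real q)\<^sup>2 * sqrt (x * (1 - x) * (y * (1 - y)) / 3)"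
    using E by linarith
  then have "(real q)\<^sup>2 * (x * y - \<tau>) \<le> (real q)\<^sup>2 * sqrt (x * (1 - x) * (y * (1 - y)) / 3)" by (simp add: algebra_simps)
  then have main: "x * y - \<tau> \<le> sqrt (x * (1 - x) * (y * (1 - y)) / 3)" using q0 by (simp add: mult_le_cancel_left)
  show ?thesis
  proof (cases "x * y \<le> \<tau>")
    case True
    have "0 \<le> (1 - x) * (1 - y)" using xy by simp
    then show ?thesis using True \<tau> by (simp add: algebra_simps)
  next
    case False
    then have "0 \<le> x * y - \<tau>" by simp
    then have "(x * y - \<tau>)\<^sup>2 \<le> (sqrt (x * (1 - x) * (y * (1 - y)) / 3))\<^sup>2" using main by (rule power_mono[rotated])
    also have "\<dots> = x * (1 - x) * (y * (1 - y)) / 3" using xy by (intro real_sqrt_pow2) simp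
    finally have sq: "(x * y - \<tau>)\<^sup>2 \<le> x * (1 - x) * (y * (1 - y)) / 3" .
    have "(x * y) * (x * y - 2 * \<tau>) \<le> (x * y) * ((1 - x) * (1 - y) / 3)"
    proof -
      have "(x * y - \<tau>)\<^sup>2 = (x * y) * (x * y - 2 * \<tau>) + \<tau>\<^sup>2" by (simp add: power2_eq_square algebra_simps)
      moreover have "x * (1 - x) * (y * (1 - y)) / 3 = (x * y) * ((1 - x) * (1 - y) / 3)" by (simp add: mult_ac)
      ultimately show ?thesis using sq zero_le_power2[of \<tau>] by linarith
    qed
    moreover have "x * y > 0" using False \<tau> by linarith
    ultimately have "x * y - 2 * \<tau> \<le> (1 - x) * (1 - y) / 3" by (simp only: mult_le_cancel_left_pos)
    then show ?thesis by (simp add: algebra_simps)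
  qed
qed

section \<open>Fibres modulo 8\<close>

text \<open>The nonzero entries of the side with smaller support can be matched injectively with
  nonzero entries of the other side; a matched pair and an unmatched entry each contribute at most
  \<open>K\<close>.\<close>

lemma two_by_two_bound:
  fixes x x' y y' K :: nat
  assumes "x + y \<le> K" "x + y' \<le> K" "x' + y \<le> K" "x' + y' \<le> K"
  shows "(x + x') + (y + y') \<le> K * max (of_bool (x \<noteq> 0) + of_bool (x' \<noteq> 0)) (of_bool (y \<noteq> 0) + of_bool (y' \<noteq> 0))"
  using assms by (cases "x = 0"; cases "x' = 0"; cases "y = 0"; cases "y' = 0") (auto simp: numeral_2_eq_2)

text \<open>Here \<open>c0\<close>, ..., \<open>c3\<close> count the occupied classes modulo 8 on
  one side, grouped modulo 4. Even squares pair group i with group -i of the other side, and the odd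
  square 1 limits the occupied classes in group -i to 2 minus those in group i + 1. The two
  reflections compose to a shift, hence the cyclic sum.\<close>

lemma cyclic_max_bound:
  fixes c0 c1 c2 c3 :: nat
  assumes "c0 \<le> 2" "c1 \<le> 2" "c2 \<le> 2" "c3 \<le> 2" "2 \<le> c0 + c1 + c2 + c3" "c0 + c1 + c2 + c3 \<le> 6"
  shows "max c0 (2 - c1) + max c1 (2 - c2) + max c2 (2 - c3) + max c3 (2 - c0) \<le> 6"
proof -
  have "c0 \<in> {0,1,2}" "c1 \<in> {0,1,2}" "c2 \<in> {0,1,2}" "c3 \<in> {0,1,2}" using assms by auto
  then show ?thesis using assms(5,6) by (elim insertE emptyE; hypsubst; simp)
qed

text \<open>If \<open>y\<close> lives on the single class \<open>t\<close>, the class 1 - t of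
  \<open>x\<close> is empty, the two classes congruent to -t modulo 4 hold at most
  \<open>K - y t\<close> each, and the other five at most \<open>K\<close> each: 5K + 2(K - y
  t).\<close>

lemma Z8_single_bound:
  fixes x y :: "nat \<Rightarrow> nat" and K :: nat
  assumes s: "\<And>r s. r < 8 \<Longrightarrow> s < 8 \<Longrightarrow> (r + s) mod 8 = 1 \<Longrightarrow> x r = 0 \<or> y s = 0"
    and w: "\<And>r s. r < 8 \<Longrightarrow> s < 8 \<Longrightarrow> (r + s) mod 4 = 0 \<Longrightarrow> x r + y s \<le> K"
    and le: "\<And>r. r < 8 \<Longrightarrow> x r \<le> K" "\<And>r. r < 8 \<Longrightarrow> y r \<le> K"
    and t: "t < 8" "y t \<noteq> 0" and one: "\<And>s. s < 8 \<Longrightarrow> s \<noteq> t \<Longrightarrow> y s = 0"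
  shows "(\<Sum>s<8. y s) \<le> K \<and> (\<Sum>r<8. x r) + 2 * (\<Sum>s<8. y s) \<le> 7*K"
proof -
  have b: "(\<Sum>s<8. y s) = y t"
    using sum.remove[of "{..<8}" t y] t one by simp
  have a: "(\<Sum>r<8. x r) = x 0 + x 1 + x 2 + x 3 + x 4 + x 5 + x 6 + x 7" by (simp add: eval_nat_numeral)
  have L: "x 0 \<le> K" "x 1 \<le> K" "x 2 \<le> K" "x 3 \<le> K" "x 4 \<le> K" "x 5 \<le> K" "x 6 \<le> K" "x 7 \<le> K" "y t \<le> K"
    by (rule le; simp add: t)+
  have S: "(r + t) mod 8 = 1 \<Longrightarrow> x r = 0" if "r < 8" for r using s[of r t] that t by auto
  have W: "(r + t) mod 4 = 0 \<Longrightarrow> x r + y t \<le> K" if "r < 8" for r using w[of r t] that t by auto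
  consider "t = 0" | "t = 1" | "t = 2" | "t = 3" | "t = 4" | "t = 5" | "t = 6" | "t = 7" using t by linarith
  then have "(\<Sum>r<8. x r) + 2 * y t \<le> 7*K"
  proof cases
    case 1 show ?thesis unfolding a using S[of 1] W[of 0] W[of 4] L 1 by simp
  next
    case 2 show ?thesis unfolding a using S[of 0] W[of 3] W[of 7] L 2 by simp
  next
    case 3 show ?thesis unfolding a using S[of 7] W[of 2] W[of 6] L 3 by simp
  next
    case 4 show ?thesis unfolding a using S[of 6] W[of 1] W[of 5] L 4 by simp
  next
    case 5 show ?thesis unfolding a using S[of 5] W[of 0] W[of 4] L 5 by simp
  next
    case 6 show ?thesis unfolding a using S[of 4] W[of 3] W[of 7] L 6 by simp
  next
    case 7 show ?thesis unfolding a using S[of 3] W[of 2] W[of 6] L 7 by simp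
  next
    case 8 show ?thesis unfolding a using S[of 2] W[of 1] W[of 5] L 8 by simp
  qed
  then show ?thesis using b L by simp
qed

text \<open>\<open>K\<close> stands for density 1 in a class. With 2 to 6 occupied classes for
  \<open>x\<close>, the groups modulo 4 pair off under even squares and
  \<open>two_by_two_bound\<close> and \<open>cyclic_max_bound\<close> give \<open>6*K\<close>. With
  at most one occupied class, or at least seven (which leaves \<open>y\<close> at most one), the
  cyclic sum can exceed 6, and the last two alternatives come from
  \<open>Z8_single_bound\<close>.\<close>

lemma Z8_pair_bound:
  fixes x y :: "nat \<Rightarrow> nat" and K :: nat
  assumes s: "\<And>r s. r < 8 \<Longrightarrow> s < 8 \<Longrightarrow> (r + s) mod 8 = 1 \<Longrightarrow> x r = 0 \<or> y s = 0"
    and w: "\<And>r s. r < 8 \<Longrightarrow> s < 8 \<Longrightarrow> (r + s) mod 4 = 0 \<Longrightarrow> x r + y s \<le> K"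
    and le: "\<And>r. r < 8 \<Longrightarrow> x r \<le> K" "\<And>r. r < 8 \<Longrightarrow> y r \<le> K"
  defines "a \<equiv> \<Sum>r<8. x r" and "b \<equiv> \<Sum>s<8. y s"
  shows "a = 0 \<or> b = 0 \<or> a + b \<le> 6*K \<or> (b \<le> K \<and> a + 2*b \<le> 7*K) \<or> (a \<le> K \<and> 2*a + b \<le> 7*K)"
proof -
  define c where "c i = (of_bool (x i \<noteq> 0) + of_bool (x (i+4) \<noteq> 0) :: nat)" for i
  define d where "d i = (of_bool (y i \<noteq> 0) + of_bool (y (i+4) \<noteq> 0) :: nat)" for i
  have a: "a = (x 0 + x 4) + (x 1 + x 5) + (x 2 + x 6) + (x 3 + x 7)" by (simp add: a_def eval_nat_numeral)
  have b: "b = (y 0 + y 4) + (y 1 + y 5) + (y 2 + y 6) + (y 3 + y 7)" by (simp add: b_def eval_nat_numeral)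
  have X: "(\<Sum>r<8. of_bool (x r \<noteq> 0)) = c 0 + c 1 + c 2 + c 3" by (simp add: c_def eval_nat_numeral)
  have Y: "(\<Sum>r<8. of_bool (y r \<noteq> 0)) = d 0 + d 1 + d 2 + d 3" by (simp add: d_def eval_nat_numeral)
  have cd: "d 1 \<le> 2 - c 0" "d 0 \<le> 2 - c 1" "d 3 \<le> 2 - c 2" "d 2 \<le> 2 - c 3"
    using s[of 0 1] s[of 4 5] apply (force simp: c_def d_def of_bool_def)
    using s[of 1 0] s[of 5 4] apply (force simp: c_def d_def of_bool_def)
    using s[of 2 7] s[of 6 3] apply (force simp: c_def d_def of_bool_def)
    using s[of 3 6] s[of 7 2] apply (force simp: c_def d_def of_bool_def)
    done
  have c2: "c i \<le> 2" for i by (simp add: c_def of_bool_def)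
  have single: "\<exists>t<8. z t \<noteq> 0 \<and> (\<forall>s<8. s \<noteq> t \<longrightarrow> z s = 0)"
    if one: "(\<Sum>r<8. of_bool (z r \<noteq> 0)) \<le> (1::nat)" and nz: "(\<Sum>r<8. z r) \<noteq> 0" for z :: "nat \<Rightarrow> nat"
  proof -
    obtain t where t: "t < 8" "z t \<noteq> 0" using nz by (metis lessThan_iff sum.neutral)
    have "z s = 0" if "s < 8" "s \<noteq> t" for s
    proof (rule ccontr)
      assume "z s \<noteq> 0"
      have "(\<Sum>r\<in>{s,t}. of_bool (z r \<noteq> 0)) \<le> (\<Sum>r<8. of_bool (z r \<noteq> 0) :: nat)"
        using that t by (intro sum_mono2) auto
      then show False using \<open>z s \<noteq> 0\<close> t that one by simp
    qed
    then show ?thesis using t by blast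
  qed
  consider "2 \<le> c 0 + c 1 + c 2 + c 3 \<and> c 0 + c 1 + c 2 + c 3 \<le> 6" | "c 0 + c 1 + c 2 + c 3 \<le> 1" | "c 0 + c 1 + c 2 + c 3 \<ge> 7" by linarith
  then show ?thesis
  proof cases
    case 1
    have t0: "(x 0 + x 4) + (y 0 + y 4) \<le> K * max (c 0) (d 0)"
      unfolding c_def d_def using two_by_two_bound[OF w[of 0 0] w[of 0 4] w[of 4 0] w[of 4 4]] by simp
    have t1: "(x 1 + x 5) + (y 3 + y 7) \<le> K * max (c 1) (d 3)"
      unfolding c_def d_def using two_by_two_bound[OF w[of 1 3] w[of 1 7] w[of 5 3] w[of 5 7]] by simp
    have t2: "(x 2 + x 6) + (y 2 + y 6) \<le> K * max (c 2) (d 2)"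
      unfolding c_def d_def using two_by_two_bound[OF w[of 2 2] w[of 2 6] w[of 6 2] w[of 6 6]] by simp
    have t3: "(x 3 + x 7) + (y 1 + y 5) \<le> K * max (c 3) (d 1)"
      unfolding c_def d_def using two_by_two_bound[OF w[of 3 1] w[of 3 5] w[of 7 1] w[of 7 5]] by simp
    have "a + b = ((x 0 + x 4) + (y 0 + y 4)) + ((x 1 + x 5) + (y 3 + y 7)) + ((x 2 + x 6) + (y 2 + y 6)) + ((x 3 + x 7) + (y 1 + y 5))"
      by (simp add: a b)
    also have "\<dots> \<le> K * max (c 0) (d 0) + K * max (c 1) (d 3) + K * max (c 2) (d 2) + K * max (c 3) (d 1)"
      by (intro add_mono t0 t1 t2 t3)
    also have "\<dots> \<le> K * max (c 0) (2 - c 1) + K * max (c 1) (2 - c 2) + K * max (c 2) (2 - c 3) + K * max (c 3) (2 - c 0)"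
      using cd by (intro add_mono mult_left_mono max.mono) auto
    also have "\<dots> = K * (max (c 0) (2 - c 1) + max (c 1) (2 - c 2) + max (c 2) (2 - c 3) + max (c 3) (2 - c 0))"
      by (simp add: algebra_simps)
    also have "\<dots> \<le> K * 6"
      by (rule mult_le_mono2, rule cyclic_max_bound) (use c2 1 in simp_all)
    finally show ?thesis by simp
  next
    case 2
    show ?thesis
    proof (cases "a = 0")
      case False
      obtain t where "t < 8" "x t \<noteq> 0" "\<forall>s<8. s \<noteq> t \<longrightarrow> x s = 0"
        using single[of x] 2 False unfolding X a_def by blast
      then have "a \<le> K \<and> b + 2 * a \<le> 7 * K"
        unfolding a_def b_def
        by (intro Z8_single_bound[of y x K t] le)
          (metis s add.commute, metis w add.commute, auto)
      then show ?thesis by linarith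
    qed simp
  next
    case 3
    then have "d 0 + d 1 + d 2 + d 3 \<le> 1" using cd c2[of 0] c2[of 1] c2[of 2] c2[of 3] by linarith
    show ?thesis
    proof (cases "b = 0")
      case False
      obtain t where "t < 8" "y t \<noteq> 0" "\<forall>s<8. s \<noteq> t \<longrightarrow> y s = 0"
        using single[of y] \<open>d 0 + d 1 + d 2 + d 3 \<le> 1\<close> False unfolding Y b_def by blast
      then have "b \<le> K \<and> a + 2 * b \<le> 7 * K"
        unfolding a_def b_def by (intro Z8_single_bound[of x y K t] le s w) auto
      then show ?thesis by linarith
    qed simp
  qed
qed

section \<open>Level sets\<close>

text \<open>
  The multipliers \<open>1 + 2e\<close> and \<open>1 + 2d\<close> below come from \<open>(x - d) (y - e) \<ge> 0\<close>, which turns the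
  constraint \<open>x + y + 2xy \<le> 1\<close> into the linear inequality \<open>(1 + 2e) x + (1 + 2d) y \<le> 1 + 2de\<close>.
\<close>

lemma level_sum_bound:
  fixes u v :: "nat \<Rightarrow> real"
  assumes "antimono u" "antimono v" and u0: "\<And>t. 0 \<le> u t" "\<And>t. u t \<le> 1" and v0: "\<And>t. 0 \<le> v t" "\<And>t. v t \<le> 1"
    and tau: "0 \<le> \<tau>" "\<tau> \<le> 1/50" and K: "K \<ge> 1"
    and mid: "\<And>t. K \<le> t \<Longrightarrow> t < 5*K \<Longrightarrow> u t + v (6*K-1-t) + 2 * u t * v (6*K-1-t) \<le> 1 + 6*\<tau>"
    and lo: "\<And>j. j < K \<Longrightarrow> u (K-1-j) + v (5*K+2*j) + 2 * u (K-1-j) * v (5*K+2*j) \<le> 1 + 6*\<tau>"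
    and hi: "\<And>j. j < K \<Longrightarrow> v (K-1-j) + u (5*K+2*j) + 2 * v (K-1-j) * u (5*K+2*j) \<le> 1 + 6*\<tau>"
    and top: "u (5*K) + v (5*K) + 2 * u (5*K) * v (5*K) \<le> 1 + 6*\<tau>"
    and su: "(\<Sum>t<8*K. u t) \<ge> (3+\<epsilon>)*K" and sv: "(\<Sum>t<8*K. v t) \<ge> (3+\<epsilon>)*K" and e0: "0 \<le> \<epsilon>"
  shows "\<epsilon> \<le> 30 * \<tau>"
proof -
  define d where "d = u (5*K)"
  define e where "e = v (5*K)"
  have de: "0 \<le> d" "d \<le> 1" "0 \<le> e" "e \<le> 1" using u0 v0 by (auto simp: d_def e_def)
  have split: "(\<Sum>t<8*K. f t) = (\<Sum>t<K. f t) + (\<Sum>t=K..<5*K. f t) + (\<Sum>t=5*K..<8*K. f t)" for f :: "nat \<Rightarrow> real"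
  proof -
    have "(\<Sum>t<8*K. f t) = (\<Sum>t=0..<8*K. f t)" by (simp add: atLeast0LessThan)
    also have "\<dots> = (\<Sum>t=0..<K. f t) + (\<Sum>t=K..<8*K. f t)" by (rule sum.atLeastLessThan_concat[symmetric]) auto
    also have "(\<Sum>t=K..<8*K. f t) = (\<Sum>t=K..<5*K. f t) + (\<Sum>t=5*K..<8*K. f t)"
      by (rule sum.atLeastLessThan_concat[symmetric]) auto
    finally show ?thesis by (simp add: atLeast0LessThan)
  qed
  \<comment> \<open>The exceptional alternative 2a + b \<le> 7K ties a low level
    \<open>K-1-j\<close> to the high level \<open>5*K+2*j\<close>, that is, to every second level
    from 5K to 7K. By monotonicity this sample also dominates the skipped level and one level from
    the range 7K to 8K: three high levels for each low one.\<close>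
  have top3: "(\<Sum>t=5*K..<8*K. f t) \<le> (\<Sum>j<K. 3 * f (5*K+2*j))" if f: "antimono f" for f :: "nat \<Rightarrow> real"
  proof -
    have "(\<Sum>t=5*K..<8*K. f t) = (\<Sum>t=5*K..<7*K. f t) + (\<Sum>t=7*K..<8*K. f t)"
      by (rule sum.atLeastLessThan_concat[symmetric]) auto
    also have "(\<Sum>t=7*K..<8*K. f t) = (\<Sum>j<K. f (7*K+j))"
      by (rule sum.reindex_bij_witness[of _ "\<lambda>j. 7*K+j" "\<lambda>t. t-7*K"]) auto
    also have "(\<Sum>t=5*K..<7*K. f t) = (\<Sum>j<2*K. f (5*K+j))"
      by (rule sum.reindex_bij_witness[of _ "\<lambda>j. 5*K+j" "\<lambda>t. t-5*K"]) auto
    also have "(\<Sum>j<2*K. f (5*K+j)) = (\<Sum>j<K. f (5*K+2*j) + f (5*K+2*j+1))"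
    proof -
      have "(\<Sum>j<2*n. g j) = (\<Sum>j<n. g (2*j) + g (2*j+1))" for g :: "nat \<Rightarrow> real" and n
        by (induction n) auto
      from this[where g="\<lambda>j. f (5*K+j)"] show ?thesis by (simp add: add.assoc)
    qed
    finally have "(\<Sum>t=5*K..<8*K. f t) = (\<Sum>j<K. f (5*K+2*j) + f (5*K+2*j+1) + f (7*K+j))"
      by (simp add: sum.distrib)
    also have "\<dots> \<le> (\<Sum>j<K. 3 * f (5*K+2*j))"
    proof (rule sum_mono)
      fix j assume "j \<in> {..<K}"
      then have "f (5*K+2*j+1) \<le> f (5*K+2*j)" "f (7*K+j) \<le> f (5*K+2*j)"
        by (auto intro!: antimonoD[OF f])
      then show "f (5*K+2*j) + f (5*K+2*j+1) + f (7*K+j) \<le> 3 * f (5*K+2*j)" by simp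
    qed
    finally show ?thesis .
  qed
  have low: "(1+2*e') * (\<Sum>t<K. f t) + (1+2*d') * (\<Sum>t=5*K..<8*K. g t) \<le> K * (1 + 2*e' + 6*d'*e' + 18*\<tau>)"
    if f: "\<And>t. 0 \<le> f t" and g: "antimono g" "\<And>t. 0 \<le> g t" and e': "e' = g (5*K)" "e' \<le> 1" and d': "d' \<ge> 0"
      and R: "\<And>j. j < K \<Longrightarrow> f (K-1-j) + g (5*K+2*j) + 2 * f (K-1-j) * g (5*K+2*j) \<le> 1 + 6*\<tau>"
    for f g :: "nat \<Rightarrow> real" and e' d'
  proof -
    have "(\<Sum>t<K. f t) = (\<Sum>j<K. f (K-1-j))"
      by (rule sum.reindex_bij_witness[of _ "\<lambda>j. K-1-j" "\<lambda>t. K-1-t"]) auto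
    then have "(1+2*e') * (\<Sum>t<K. f t) + (1+2*d') * (\<Sum>t=5*K..<8*K. g t)
       \<le> (1+2*e') * (\<Sum>j<K. f (K-1-j)) + (1+2*d') * (\<Sum>j<K. 3 * g (5*K+2*j))"
      using top3[OF g(1)] d' g(2)[of "5*K"] e' by (intro add_mono mult_left_mono) auto
    also have "\<dots> = (\<Sum>j<K. (1+2*e') * f (K-1-j) + (1+2*d') * (3 * g (5*K+2*j)))"
      by (simp add: sum.distrib sum_distrib_left)
    also have "\<dots> \<le> (\<Sum>j<K. 1 + 2*e' + 6*d'*e' + 18*\<tau>)"
    proof (rule sum_mono)
      fix j assume "j \<in> {..<K}"
      then have j: "j < K" by simp
      define x y where "x = f (K-1-j)" and "y = g (5*K+2*j)"
      have y: "0 \<le> y" "y \<le> e'" unfolding y_def e' using g by (auto intro: antimonoD)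
      have x: "0 \<le> x" using f x_def by simp
      have r: "x * (1 + 2*y) \<le> 1 + 6*\<tau> - y" using R[OF j] by (simp add: x_def y_def algebra_simps)
      \<comment> \<open>The constraint x \<le> (1 + 6\<tau> - y)/(1 + 2y) is replaced by a linear
        bound with slope -3 in y, valid because 0 \<le> y \<le> e'. The slope is chosen to cancel
        the three copies of y supplied by \<open>top3\<close>.\<close>
      have "(1 + 2*e') * (x * (1 + 2*y)) \<le> (1 + 2*e') * (1 + 6*\<tau> - y)"
        using r y by (intro mult_left_mono) auto
      also have "\<dots> \<le> (1 + 2*e' - 3*y + 18*\<tau>) * (1+2*y)"
      proof -
        have "0 \<le> 6*y*(e'-y)" using y by simp
        moreover have "(1+2*e')*\<tau> \<le> 3*\<tau>" using e' tau by (intro mult_right_mono) auto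
        moreover have "0 \<le> \<tau> * y" using tau y by simp
        ultimately show ?thesis by (simp add: algebra_simps)
      qed
      finally have "(1 + 2*e') * x * (1+2*y) \<le> (1 + 2*e' - 3*y + 18*\<tau>) * (1+2*y)" by (simp add: mult.assoc)
      then have "(1+2*e')*x \<le> 1 + 2*e' - 3*y + 18*\<tau>" using y by (simp add: mult_le_cancel_right)
      moreover have "6*d'*y \<le> 6*d'*e'" using y d' by (intro mult_left_mono) auto
      ultimately show "(1+2*e') * f (K-1-j) + (1+2*d') * (3 * g (5*K+2*j)) \<le> 1 + 2*e' + 6*d'*e' + 18*\<tau>"
        by (simp add: x_def y_def algebra_simps)
    qed
    finally show ?thesis by simp
  qed
  have L1: "(1+2*e) * (\<Sum>t<K. u t) + (1+2*d) * (\<Sum>t=5*K..<8*K. v t) \<le> K * (1 + 2*e + 6*d*e + 18*\<tau>)"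
    by (rule low) (use assms de lo e_def in auto)
  have L2: "(1+2*d) * (\<Sum>t<K. v t) + (1+2*e) * (\<Sum>t=5*K..<8*K. u t) \<le> K * (1 + 2*d + 6*e*d + 18*\<tau>)"
    by (rule low) (use assms de hi d_def in auto)
  have L3: "(1+2*e) * (\<Sum>t=K..<5*K. u t) + (1+2*d) * (\<Sum>t=K..<5*K. v t) \<le> 4*K*(1+2*d*e+6*\<tau>)"
  proof -
    have "(\<Sum>t=K..<5*K. v t) = (\<Sum>t=K..<5*K. v (6*K-1-t))"
      by (rule sum.reindex_bij_witness[of _ "\<lambda>t. 6*K-1-t" "\<lambda>t. 6*K-1-t"]) auto
    then have "(1+2*e) * (\<Sum>t=K..<5*K. u t) + (1+2*d) * (\<Sum>t=K..<5*K. v t)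
      = (\<Sum>t=K..<5*K. (1+2*e) * u t + (1+2*d) * v (6*K-1-t))"
      by (simp add: sum.distrib sum_distrib_left)
    also have "\<dots> \<le> (\<Sum>t=K..<5*K. 1+2*d*e+6*\<tau>)"
    proof (rule sum_mono)
      fix t assume "t \<in> {K..<5*K}"
      then have t: "K \<le> t" "t < 5*K" by auto
      have "d \<le> u t" unfolding d_def by (rule antimonoD[OF assms(1)]) (use t in auto)
      moreover have "e \<le> v (6*K-1-t)" unfolding e_def by (rule antimonoD[OF assms(2)]) (use t in auto)
      ultimately have "0 \<le> (u t - d) * (v (6*K-1-t) - e)" by simp
      then show "(1+2*e) * u t + (1+2*d) * v (6*K-1-t) \<le> 1+2*d*e+6*\<tau>"
        using mid[OF t] by (simp add: algebra_simps)
    qed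
    finally show ?thesis by simp
  qed
  have "(1+2*e)*((3+\<epsilon>)*K) + (1+2*d)*((3+\<epsilon>)*K) \<le> (1+2*e) * (\<Sum>t<8*K. u t) + (1+2*d) * (\<Sum>t<8*K. v t)"
    using su sv de by (intro add_mono mult_left_mono) auto
  also have "\<dots> \<le> K * (6 + 2*d + 2*e + 20*d*e + 60*\<tau>)"
    using L1 L2 L3 unfolding split[of u] split[of v] by (simp add: algebra_simps)
  finally have "K * ((2+2*d+2*e)*(3+\<epsilon>)) \<le> K * (6 + 2*d + 2*e + 20*d*e + 60*\<tau>)" by (simp add: algebra_simps)
  then have "(2+2*d+2*e)*(3+\<epsilon>) \<le> 6 + 2*d + 2*e + 20*d*e + 60*\<tau>" using K by (simp add: mult_le_cancel_left)
  moreover have "0 \<le> (d+e)*\<epsilon>" using de e0 by simp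
  ultimately have main: "4*(d+e) + 2*\<epsilon> \<le> 20*d*e+60*\<tau>" by (simp add: algebra_simps)
  \<comment> \<open>This absorbs the term 20de of \<open>main\<close> into 4(d + e). By AM-GM,
    \<open>top\<close> bounds s = sqrt(de) through 2s + 2s^2 \<le> 1 + 6\<tau>, and s \<le> 2/5 is
    what is needed; there the left side is 1.12, which is the origin of the hypothesis \<tau> \<le>
    1/50.\<close>
  have "5*(d*e) \<le> d+e"
  proof -
    define s where "s = sqrt (d*e)"
    have s: "0 \<le> s" "s * s = d*e" using de by (auto simp: s_def)
    have am: "2 * s \<le> d+e" using arith_geo_mean_sqrt[of d e] de by (simp add: s_def)
    have "2 * s + 2*(s * s) \<le> 1 + 6*\<tau>" using top am s by (simp add: d_def e_def)
    then have "2 * s+2*(s * s) \<le> 112/100" using tau by simp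
    have "s \<le> 2/5"
    proof (rule ccontr)
      assume "\<not> s \<le> 2/5"
      then have a: "s > 2/5" by simp
      then have "s * s \<ge> (2/5)*(2/5)" by (intro mult_mono) auto
      then show False using \<open>2 * s+2*(s * s) \<le> 112/100\<close> a by simp
    qed
    then have "s * s \<le> (2/5) * s" using s by (intro mult_right_mono) auto
    then show ?thesis using am s by simp
  qed
  then show ?thesis using main by simp
qed

text \<open>
  Here \<open>\<alpha> r u\<close> stands for the density of a set in the class \<open>r\<close> modulo 8 and \<open>u\<close> modulo \<open>q\<close>. Odd squares
  are equidistributed in the class 1 modulo 8, so any two dense classes with sum 1 are joined; an even
  square only gives a matching between classes, so there the densities must add up to more than 1.
\<close>

definition violating :: "real \<Rightarrow> nat \<Rightarrow> (nat \<Rightarrow> nat \<Rightarrow> real) \<Rightarrow> (nat \<Rightarrow> nat \<Rightarrow> real) \<Rightarrow> (nat \<times> nat) set" where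
  "violating \<delta> q \<alpha> \<beta> = {(u, v). u < q \<and> v < q \<and>
     ((\<exists>r<8. \<exists>s<8. (r + s) mod 8 = 1 \<and> \<alpha> r u > \<delta> \<and> \<beta> s v > \<delta>) \<or>
      (\<exists>r<8. \<exists>s<8. (r + s) mod 4 = 0 \<and> \<alpha> r u + \<beta> s v > 1 + 2 * \<delta>))}"

section \<open>Quantised fibre densities and the number of violating edges\<close>

lemma sum_card_levels:
  fixes a :: "nat \<Rightarrow> nat"
  assumes "\<And>u. u < q \<Longrightarrow> a u \<le> n"
  shows "(\<Sum>t<n. card {u. u < q \<and> t < a u}) = (\<Sum>u<q. a u)"
proof -
  have "(\<Sum>t<n. card {u. u < q \<and> t < a u}) = (\<Sum>t<n. \<Sum>u<q. if t < a u then 1 else 0)"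
    by (intro sum.cong refl) (auto simp: sum.If_cases intro!: arg_cong[where f = card])
  also have "\<dots> = (\<Sum>u<q. \<Sum>t<n. if t < a u then 1 else 0)" by (rule sum.swap)
  also have "\<dots> = (\<Sum>u<q. a u)"
  proof (rule sum.cong[OF refl])
    fix u assume "u \<in> {..<q}"
    then have "{..<n} \<inter> {t. t < a u} = {..<a u}" using assms[of u] by auto
    then show "(\<Sum>t<n. if t < a u then 1 else 0) = a u" by (simp add: sum.If_cases)
  qed
  finally show ?thesis .
qed

text \<open>If violating pairs carried few edges, any two level sets whose product consists of
  violating pairs would be nearly edge-free, so \<open>spectral_bound\<close> would supply every
  hypothesis of \<open>level_sum_bound\<close>. Its conclusion would read 4\<epsilon> \<le>
  30\<epsilon>/50. The drop from 7\<epsilon> to 4\<epsilon> pays for the rounding: 8\<delta> =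
  2\<epsilon> for the shift by \<delta> in eight classes and \<epsilon> for the floors.\<close>

lemma violating_edges:
  fixes \<alpha> \<beta> :: "nat \<Rightarrow> nat \<Rightarrow> real" and \<epsilon> :: real and q :: nat
  assumes q: "odd q" and eps: "0 < \<epsilon>" "\<epsilon> \<le> 5/8"
    and a1: "\<And>r u. r < 8 \<Longrightarrow> u < q \<Longrightarrow> \<alpha> r u \<le> 1" and b1: "\<And>r u. r < 8 \<Longrightarrow> u < q \<Longrightarrow> \<beta> r u \<le> 1"
    and sa: "(\<Sum>u<q. \<Sum>r<8. \<alpha> r u) \<ge> (3 + 7 * \<epsilon>) * q" and sb: "(\<Sum>u<q. \<Sum>r<8. \<beta> r u) \<ge> (3 + 7 * \<epsilon>) * q"
  shows "(\<Sum>(u, v)\<in>violating (\<epsilon>/4) q \<alpha> \<beta>. real (sqrt_count q (u + v))) \<ge> \<epsilon> / 50 * (real q)\<^sup>2"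
proof (rule ccontr)
  assume contra: "\<not> ?thesis"
  define \<delta> where "\<delta> = \<epsilon> / 4"
  define \<tau> where "\<tau> = \<epsilon> / 50"
  define Vi where "Vi = violating \<delta> q \<alpha> \<beta>"
  have few: "(\<Sum>(u, v)\<in>Vi. real (sqrt_count q (u + v))) \<le> \<tau> * (real q)\<^sup>2"
    using contra by (simp add: Vi_def \<delta>_def \<tau>_def)
  have q0: "q > 0" using q by (simp add: odd_pos)
  have fV: "finite Vi" unfolding Vi_def violating_def by (rule finite_subset[of _ "{..<q} \<times> {..<q}"]) auto
  \<comment> \<open>Rounding down eight densities loses at most 8 units, which is at most \<epsilon>
    \<open>K\<close>.\<close>
  define K where "K = nat \<lceil>8 / \<epsilon>\<rceil>"
  have K: "real K \<ge> 8 / \<epsilon>" unfolding K_def by (rule real_nat_ceiling_ge)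
  have K1: "K \<ge> 1" unfolding K_def using eps by (simp add: Suc_le_eq)
  have Ke: "real K * \<epsilon> \<ge> 8" using K eps by (simp add: field_simps)
  \<comment> \<open>Subtracting \<delta> first makes a nonzero value imply density above \<delta>,
    and makes two nonzero values sum to at most \<open>K\<close> when the densities sum to at most 1
    + 2\<delta>. These are the two hypotheses of \<open>Z8_pair_bound\<close>. \<open>nat\<close>
    turns negative values into 0, which only increases the sum.\<close>
  define X where "X f r u = nat \<lfloor>real K * (f r u - \<delta>)\<rfloor>" for f :: "nat \<Rightarrow> nat \<Rightarrow> real" and r u :: nat
  define S where "S f u = (\<Sum>r<8. X f r u)" for f u
  define L where "L f t = {u. u < q \<and> t < S f u}" for f t
  define l where "l f t = real (card (L f t)) / real q" for f t
  have d0: "\<delta> > 0" using eps by (simp add: \<delta>_def)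
  have Xle: "X f r u \<le> K" if "f r u \<le> 1" for f r u
  proof -
    have "real K * (f r u - \<delta>) \<le> real K * 1" using that d0 by (intro mult_left_mono) auto
    then show ?thesis unfolding X_def by linarith
  qed
  have Xpos: "real (X f r u) \<le> real K * (f r u - \<delta>) \<and> f r u > \<delta>" if "X f r u \<noteq> 0" for f r u
  proof -
    have f: "\<lfloor>real K * (f r u - \<delta>)\<rfloor> \<ge> 1" using that unfolding X_def by linarith
    then have "real K * (f r u - \<delta>) > 0" by linarith
    then have "f r u > \<delta>" using K1 by (simp add: zero_less_mult_iff)
    moreover have "real (X f r u) \<le> real K * (f r u - \<delta>)" using f unfolding X_def by linarith
    ultimately show ?thesis by simp
  qed
  have Xge: "real (X f r u) \<ge> real K * (f r u - \<delta>) - 1" for f r u unfolding X_def by linarith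
  have Sle: "S f u \<le> 8 * K" if "\<And>r. r < 8 \<Longrightarrow> f r u \<le> 1" for f u
    unfolding S_def using sum_bounded_above[of "{..<8}" "\<lambda>r. X f r u" K] Xle that by simp
  have Ssum: "(\<Sum>u<q. real (S f u)) \<ge> (3 + 4 * \<epsilon>) * K * q" if "(\<Sum>u<q. \<Sum>r<8. f r u) \<ge> (3 + 7 * \<epsilon>) * q" for f
  proof -
    have "(\<Sum>u<q. real (S f u)) \<ge> (\<Sum>u<q. \<Sum>r<8. real K * (f r u - \<delta>) - 1)"
      unfolding S_def of_nat_sum by (intro sum_mono Xge)
    also have "(\<Sum>u<q. \<Sum>r<8. real K * (f r u - \<delta>) - 1) = real K * (\<Sum>u<q. \<Sum>r<8. f r u) - 8 * real K * \<delta> * q - 8 * q"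
      by (simp add: sum_subtractf sum_distrib_left right_diff_distrib)
    finally have 1: "(\<Sum>u<q. real (S f u)) \<ge> real K * (\<Sum>u<q. \<Sum>r<8. f r u) - 8 * real K * \<delta> * q - 8 * q" .
    have 2: "real K * (\<Sum>u<q. \<Sum>r<8. f r u) \<ge> real K * ((3 + 7 * \<epsilon>) * q)" using that by (intro mult_left_mono) auto
    have 3: "8 * real q \<le> (real K * \<epsilon>) * q" using Ke by (intro mult_right_mono) auto
    show ?thesis using 1 2 3 by (simp add: \<delta>_def algebra_simps)
  qed
  have lsum: "(\<Sum>t<8*K. l f t) \<ge> (3 + 4 * \<epsilon>) * K"
    if "(\<Sum>u<q. \<Sum>r<8. f r u) \<ge> (3 + 7 * \<epsilon>) * q" "\<And>r u. r < 8 \<Longrightarrow> u < q \<Longrightarrow> f r u \<le> 1" for f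
  proof -
    have "(\<Sum>t<8*K. l f t) = real (\<Sum>t<8*K. card (L f t)) / q" by (simp add: l_def sum_divide_distrib)
    also have "(\<Sum>t<8*K. card (L f t)) = (\<Sum>u<q. S f u)"
      unfolding L_def by (rule sum_card_levels) (use Sle that in auto)
    finally show ?thesis using Ssum[OF that(1)] q0 by (simp add: pos_le_divide_eq)
  qed
  have finL: "finite (L f t)" "L f t \<subseteq> {..<q}" for f t by (auto simp: L_def)
  have anti: "antimono (l f)" for f
  proof (rule antimonoI)
    fix s t :: nat assume "s \<le> t"
    then have "card (L f t) \<le> card (L f s)" by (intro card_mono) (auto simp: L_def)
    then show "l f t \<le> l f s" by (simp add: l_def divide_right_mono)
  qed
  have l01: "0 \<le> l f t" "l f t \<le> 1" for f t
  proof -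
    have "card (L f t) \<le> q" using card_mono[OF _ finL(2)] by fastforce
    then show "0 \<le> l f t" "l f t \<le> 1" using q0 by (auto simp: l_def)
  qed
  have nonviol: "S \<alpha> u = 0 \<or> S \<beta> v = 0 \<or> S \<alpha> u + S \<beta> v \<le> 6*K \<or> (S \<beta> v \<le> K \<and> S \<alpha> u + 2 * S \<beta> v \<le> 7*K) \<or> (S \<alpha> u \<le> K \<and> 2 * S \<alpha> u + S \<beta> v \<le> 7*K)"
    if uv: "u < q" "v < q" "(u, v) \<notin> Vi" for u v
    unfolding S_def
  proof (rule Z8_pair_bound)
    fix r s :: nat assume rs: "r < 8" "s < 8"
    show "X \<alpha> r u \<le> K" "X \<beta> r v \<le> K" using rs uv a1 b1 by (auto intro!: Xle)
    { assume m: "(r + s) mod 8 = 1"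
      show "X \<alpha> r u = 0 \<or> X \<beta> s v = 0"
        using uv rs m Xpos[of \<alpha> r u] Xpos[of \<beta> s v] unfolding Vi_def violating_def by blast }
    { assume m: "(r + s) mod 4 = 0"
      show "X \<alpha> r u + X \<beta> s v \<le> K"
      proof (cases "X \<alpha> r u = 0 \<or> X \<beta> s v = 0")
        case True then show ?thesis using Xle[of \<alpha> r u] Xle[of \<beta> s v] a1 b1 rs uv by auto
      next
        case False
        have "\<alpha> r u + \<beta> s v \<le> 1 + 2 * \<delta>" using uv rs m unfolding Vi_def violating_def by force
        then have "real K * ((\<alpha> r u - \<delta>) + (\<beta> s v - \<delta>)) \<le> real K * 1" by (intro mult_left_mono) auto
        moreover have "real (X \<alpha> r u) \<le> real K * (\<alpha> r u - \<delta>)" "real (X \<beta> s v) \<le> real K * (\<beta> s v - \<delta>)"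
          using Xpos[of \<alpha> r u] Xpos[of \<beta> s v] False by auto
        ultimately have "real (X \<alpha> r u) + real (X \<beta> s v) \<le> real K"
          unfolding distrib_left by linarith
        then show ?thesis by linarith
      qed }
  qed
  have R: "l \<alpha> t + l \<beta> s + 2 * l \<alpha> t * l \<beta> s \<le> 1 + 6 * \<tau>"
    if v: "\<And>u v. u < q \<Longrightarrow> v < q \<Longrightarrow> t < S \<alpha> u \<Longrightarrow> s < S \<beta> v \<Longrightarrow> (u, v) \<in> Vi" for t s
    unfolding l_def
  proof (rule spectral_bound[OF q finL(2) finL(2)])
    have "(\<Sum>u\<in>L \<alpha> t. \<Sum>v\<in>L \<beta> s. real (sqrt_count q (u + v))) = (\<Sum>(u,v)\<in>L \<alpha> t \<times> L \<beta> s. real (sqrt_count q (u + v)))"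
      by (rule sum.cartesian_product)
    also have "\<dots> \<le> (\<Sum>(u, v)\<in>Vi. real (sqrt_count q (u + v)))"
      using v by (intro sum_mono2 fV) (auto simp: L_def)
    also note few
    finally show "(\<Sum>u\<in>L \<alpha> t. \<Sum>v\<in>L \<beta> s. real (sqrt_count q (u + v))) \<le> \<tau> * (real q)\<^sup>2" .
    show "\<tau> \<ge> 0" using eps by (simp add: \<tau>_def)
  qed
  have "4 * \<epsilon> \<le> 30 * \<tau>"
  proof (rule level_sum_bound[OF anti[of \<alpha>] anti[of \<beta>] l01 l01 _ _ K1])
    show "0 \<le> \<tau>" "\<tau> \<le> 1/50" using eps by (auto simp: \<tau>_def)
    show "(3 + 4 * \<epsilon>) * real K \<le> sum (l \<alpha>) {..<8 * K}" "(3 + 4 * \<epsilon>) * real K \<le> sum (l \<beta>) {..<8 * K}"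
      using lsum[OF sa] lsum[OF sb] a1 b1 by auto
    show "0 \<le> 4 * \<epsilon>" using eps by simp
    show "l \<alpha> (5 * K) + l \<beta> (5 * K) + 2 * l \<alpha> (5 * K) * l \<beta> (5 * K) \<le> 1 + 6 * \<tau>"
    proof (rule R)
      fix u v assume "u < q" "v < q" "5 * K < S \<alpha> u" "5 * K < S \<beta> v"
      then show "(u, v) \<in> Vi" using nonviol[of u v] by linarith
    qed
    \<comment> \<open>Level membership is strict, so members satisfy S \<alpha> u \<ge> t + 1 and S
      \<beta> v \<ge> 6K - t: the total exceeds 6K by one. The range of t also puts both above K,
      which rules out the exceptional alternatives.\<close>
    show "l \<alpha> t + l \<beta> (6 * K - 1 - t) + 2 * l \<alpha> t * l \<beta> (6 * K - 1 - t) \<le> 1 + 6 * \<tau>" if "K \<le> t" "t < 5 * K" for t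
    proof (rule R)
      fix u v assume "u < q" "v < q" "t < S \<alpha> u" "6 * K - 1 - t < S \<beta> v"
      then show "(u, v) \<in> Vi" using nonviol[of u v] that by linarith
    qed
    fix j assume j: "j < K"
    \<comment> \<open>Now S \<alpha> u \<ge> K - j and S \<beta> v \<ge> 5K + 2j + 1, so 2a + b
      \<ge> 7K + 1 and a + b > 6K; moreover b > K, so no alternative survives.\<close>
    show "l \<alpha> (K-1-j) + l \<beta> (5*K+2*j) + 2 * l \<alpha> (K-1-j) * l \<beta> (5*K+2*j) \<le> 1 + 6 * \<tau>"
    proof (rule R)
      fix u v assume "u < q" "v < q" "K-1-j < S \<alpha> u" "5*K+2*j < S \<beta> v"
      then show "(u, v) \<in> Vi" using nonviol[of u v] j by linarith
    qed
    have "l \<alpha> (5*K+2*j) + l \<beta> (K-1-j) + 2 * l \<alpha> (5*K+2*j) * l \<beta> (K-1-j) \<le> 1 + 6 * \<tau>"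
    proof (rule R)
      fix u v assume "u < q" "v < q" "5*K+2*j < S \<alpha> u" "K-1-j < S \<beta> v"
      then show "(u, v) \<in> Vi" using nonviol[of u v] j by linarith
    qed
    then show "l \<beta> (K-1-j) + l \<alpha> (5*K+2*j) + 2 * l \<beta> (K-1-j) * l \<alpha> (5*K+2*j) \<le> 1 + 6 * \<tau>"
      by (simp add: mult_ac)
  qed
  then show False using eps by (simp add: \<tau>_def)
qed

section \<open>Weyl sums\<close>

lemma norm_cis_minus_one: "norm (cis t - 1) = 2 * \<bar>sin (t / 2)\<bar>"
  using dist_exp_i_1[of t] by (simp add: cis_conv_exp)

lemma norm_cis_minus_one_le: "norm (cis t - 1) \<le> \<bar>t\<bar>"
  using abs_sin_x_le_abs_x[of "t/2"] by (simp add: norm_cis_minus_one)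

text \<open>Jordan's inequality: on [0, pi/2] the concave sine lies above its chord.\<close>

lemma norm_cis_minus_one_ge:
  assumes "\<bar>t\<bar> \<le> pi"
  shows "norm (cis t - 1) \<ge> 2 * \<bar>t\<bar> / pi"
proof -
  define s where "s = \<bar>t\<bar> / pi"
  have s: "0 \<le> s" "s \<le> 1" using assms by (auto simp: s_def)
  have "concave_on {0..pi} sin"
    by (rule f''_le0_imp_concave[where f' = cos and f'' = "\<lambda>x. - sin x"])
      (auto intro!: derivative_eq_intros sin_ge_zero)
  from concave_onD[OF this s, of 0 "pi/2"] have "s \<le> sin (s * (pi/2))" by simp
  also have "s * (pi/2) = \<bar>t\<bar> / 2" by (simp add: s_def)
  also have "sin (\<bar>t\<bar> / 2) \<le> \<bar>sin (t / 2)\<bar>" by (cases "t \<ge> 0") auto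
  finally show ?thesis by (simp add: norm_cis_minus_one s_def)
qed

lemma geometric_cis_bound:
  fixes \<phi> :: real
  assumes "\<delta> > 0" "\<bar>\<phi> - of_int (round \<phi>)\<bar> > \<delta>"
  shows "norm (\<Sum>m=a..<b. cis (2*pi*(\<phi> * real m))) \<le> 1 / (2*\<delta>)"
proof (cases "a \<le> b")
  case True
  define w where "w = cis (2*pi*\<phi>)"
  have w: "cis (2*pi*(\<phi> * real m)) = w ^ m" for m
    unfolding w_def Complex.DeMoivre by (intro arg_cong[where f = cis]) simp
  define \<psi> where "\<psi> = \<phi> - of_int (round \<phi>)"
  have "w = cis (2*pi*\<psi>)"
  proof -
    have "w = cis (2*pi*\<psi>) * cis (2 * pi * of_int (round \<phi>))"
      unfolding w_def cis_mult \<psi>_def by (intro arg_cong[where f = cis]) (simp add: algebra_simps)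
    also have "cis (2 * pi * of_int (round \<phi>)) = 1" by (intro cis_multiple_2pi Ints_of_int)
    finally show ?thesis by simp
  qed
  have psi: "\<bar>\<psi>\<bar> \<le> 1/2" "\<bar>\<psi>\<bar> > \<delta>" unfolding \<psi>_def using of_int_round_abs_le[of \<phi>] assms(2) by (simp_all add: abs_minus_commute)
  have "norm (w - 1) \<ge> 2 * \<bar>2*pi*\<psi>\<bar> / pi"
    unfolding \<open>w = cis (2*pi*\<psi>)\<close> using psi by (intro norm_cis_minus_one_ge) (simp add: abs_mult)
  then have nw: "norm (w - 1) > 4 * \<delta>" using psi by (simp add: abs_mult)
  have "(\<Sum>m=a..<b. w ^ m) * (w - 1) = w ^ b - w ^ a"
    using True
  proof (induction b rule: dec_induct)
    case (step n)
    then have "(\<Sum>m=a..<Suc n. w ^ m) * (w - 1) = (\<Sum>m=a..<n. w ^ m) * (w - 1) + w ^ n * (w - 1)"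
      by (simp add: algebra_simps)
    then show ?case using step by (simp add: algebra_simps)
  qed simp
  then have "norm (\<Sum>m=a..<b. w ^ m) * norm (w - 1) = norm (w ^ b - w ^ a)" by (metis norm_mult)
  also have "\<dots> \<le> 1 + 1" by (rule order_trans[OF norm_triangle_ineq4]) (simp add: norm_power w_def)
  finally have "norm (\<Sum>m=a..<b. w ^ m) * norm (w - 1) \<le> 2" by simp
  moreover have "norm (\<Sum>m=a..<b. w ^ m) * (4 * \<delta>) \<le> norm (\<Sum>m=a..<b. w ^ m) * norm (w - 1)"
    using nw by (intro mult_left_mono) auto
  ultimately show ?thesis unfolding w using assms(1) by (simp add: field_simps)
qed (use assms in simp)

text \<open>Off-diagonal pairs in the expanded square form two conjugate halves; grouping one half
  by the difference \<open>h\<close> leaves a phase linear in \<open>m\<close>, since the quadratic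
  terms cancel.\<close>

lemma weyl_differencing:
  fixes \<theta> :: real and M :: nat
  defines "S \<equiv> (\<Sum>m=1..M. cis (2*pi*(\<theta> * (real m)\<^sup>2)))"
  shows "(norm S)\<^sup>2 \<le> real M + 2 * (\<Sum>h=1..<M. norm (\<Sum>m=1..<M+1-h. cis (2*pi*(2*\<theta>*real h * real m))))"
proof -
  define e where "e x = cis (2*pi*(\<theta> * x))" for x :: real
  define T where "T h = (\<Sum>m=1..<M+1-h. e ((real (m+h))\<^sup>2 - (real m)\<^sup>2))" for h
  define I where "I = {1..M}"
  have e_mult: "e x * cnj (e y) = e (x - y)" for x y
    unfolding e_def cis_cnj cis_inverse[symmetric] by (simp add: cis_mult algebra_simps cis_inverse)
  have T: "norm (T h) = norm (\<Sum>m=1..<M+1-h. cis (2*pi*(2*\<theta>*real h * real m)))" for h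
  proof -
    have "T h = e ((real h)\<^sup>2) * (\<Sum>m=1..<M+1-h. cis (2*pi*(2*\<theta>*real h * real m)))"
      unfolding T_def sum_distrib_left e_def cis_mult
      by (intro sum.cong refl arg_cong[where f = cis]) (simp add: power2_eq_square algebra_simps)
    then show ?thesis by (simp add: norm_mult e_def)
  qed
  have half: "(\<Sum>(m,n)\<in>{(m,n)\<in>I \<times> I. n < m}. e ((real m)\<^sup>2 - (real n)\<^sup>2)) = (\<Sum>h=1..<M. T h)"
  proof -
    have "(\<Sum>h=1..<M. T h) = (\<Sum>(h,m)\<in>(SIGMA h:{1..<M}. {1..<M+1-h}). e ((real (m+h))\<^sup>2 - (real m)\<^sup>2))"
      unfolding T_def by (subst sum.Sigma) auto
    also have "\<dots> = (\<Sum>(m,n)\<in>{(m,n)\<in>I \<times> I. n < m}. e ((real m)\<^sup>2 - (real n)\<^sup>2))"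
      by (rule sum.reindex_bij_witness[of _ "\<lambda>(m,n). (m - n, n)" "\<lambda>(h,m). (m + h, m)"]) (auto simp: I_def)
    finally show ?thesis by simp
  qed
  have half': "(\<Sum>(m,n)\<in>{(m,n)\<in>I \<times> I. m < n}. e ((real m)\<^sup>2 - (real n)\<^sup>2)) = cnj (\<Sum>h=1..<M. T h)"
  proof -
    have "(\<Sum>(m,n)\<in>{(m,n)\<in>I \<times> I. m < n}. e ((real m)\<^sup>2 - (real n)\<^sup>2))
       = (\<Sum>(m,n)\<in>{(m,n)\<in>I \<times> I. n < m}. e ((real n)\<^sup>2 - (real m)\<^sup>2))"
      by (rule sum.reindex_bij_witness[of _ "\<lambda>(m,n). (n, m)" "\<lambda>(m,n). (n, m)"]) auto
    also have "\<dots> = (\<Sum>(m,n)\<in>{(m,n)\<in>I \<times> I. n < m}. cnj (e ((real m)\<^sup>2 - (real n)\<^sup>2)))"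
      by (intro sum.cong refl) (auto simp: e_def cis_cnj cis_inverse algebra_simps)
    finally show ?thesis unfolding half[symmetric] by (simp add: case_prod_unfold)
  qed
  have diag: "(\<Sum>(m,n)\<in>{(m,n)\<in>I \<times> I. m = n}. e ((real m)\<^sup>2 - (real n)\<^sup>2)) = of_nat M"
  proof -
    have "(\<Sum>(m,n)\<in>{(m,n)\<in>I \<times> I. m = n}. e ((real m)\<^sup>2 - (real n)\<^sup>2)) = (\<Sum>m\<in>I. 1)"
      by (rule sum.reindex_bij_witness[of _ "\<lambda>m. (m, m)" fst]) (auto simp: e_def)
    then show ?thesis by (simp add: I_def)
  qed
  have "complex_of_real ((norm S)\<^sup>2) = (\<Sum>m\<in>I. \<Sum>n\<in>I. e ((real m)\<^sup>2 - (real n)\<^sup>2))"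
    unfolding complex_norm_square S_def e_def[symmetric] cnj_sum sum_product e_mult I_def ..
  also have "\<dots> = (\<Sum>(m,n)\<in>I \<times> I. e ((real m)\<^sup>2 - (real n)\<^sup>2))" by (rule sum.cartesian_product)
  also have "I \<times> I = ({(m,n)\<in>I \<times> I. n < m} \<union> {(m,n)\<in>I \<times> I. m < n}) \<union> {(m,n)\<in>I \<times> I. m = n}" by auto
  also have "(\<Sum>(m,n)\<in>\<dots>. e ((real m)\<^sup>2 - (real n)\<^sup>2)) = (\<Sum>h=1..<M. T h) + cnj (\<Sum>h=1..<M. T h) + of_nat M"
  proof -
    have fin: "finite (I \<times> I)" by (simp add: I_def)
    have un: "sum f ((P1 \<union> P2) \<union> P3) = sum f P1 + sum f P2 + sum f P3"
      if "P1 \<subseteq> I \<times> I" "P2 \<subseteq> I \<times> I" "P3 \<subseteq> I \<times> I" "P1 \<inter> P2 = {}" "(P1 \<union> P2) \<inter> P3 = {}"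
      for f :: "nat \<times> nat \<Rightarrow> complex" and P1 P2 P3
      using that finite_subset[OF _ fin] by (simp add: sum.union_disjoint)
    have "sum f ({(m,n)\<in>I \<times> I. n < m} \<union> {(m,n)\<in>I \<times> I. m < n} \<union> {(m,n)\<in>I \<times> I. m = n})
      = sum f {(m,n)\<in>I \<times> I. n < m} + sum f {(m,n)\<in>I \<times> I. m < n} + sum f {(m,n)\<in>I \<times> I. m = n}"
      for f :: "nat \<times> nat \<Rightarrow> complex" by (rule un) auto
    then show ?thesis by (simp only: half half' diag)
  qed
  finally have "(norm S)\<^sup>2 = norm ((\<Sum>h=1..<M. T h) + cnj (\<Sum>h=1..<M. T h) + of_nat M)"
    by (metis abs_of_nonneg norm_of_real zero_le_power2)
  also have "\<dots> \<le> norm (\<Sum>h=1..<M. T h) + norm (cnj (\<Sum>h=1..<M. T h)) + norm (of_nat M :: complex)"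
    by (meson add_right_mono norm_triangle_ineq order_trans)
  also have "\<dots> = real M + 2 * norm (\<Sum>h=1..<M. T h)" by (simp only: complex_mod_cnj norm_of_nat)
  also have "\<dots> \<le> real M + 2 * (\<Sum>h=1..<M. norm (T h))" by (intro add_left_mono mult_left_mono norm_sum) simp
  finally show ?thesis by (simp only: T)
qed

text \<open>\<delta> is chosen so that a geometric sum with phase farther than \<delta> from the
  integers is at most 1/(2\<delta>) = \<eta>^2 M/4. Such \<open>h\<close> then account for at most
  half of \<eta>^2 M^2, and the rest must come from good \<open>h\<close>, each contributing at most
  an extra \<open>M\<close>. The lower bound on \<open>M\<close> absorbs the diagonal term.\<close>

lemma many_good_differences:
  fixes \<theta> \<eta> :: real and M :: nat
  assumes eta: "\<eta> > 0" and M: "real M \<ge> 8 / \<eta>\<^sup>2" and S: "norm (\<Sum>m=1..M. cis (2*pi*(\<theta> * (real m)\<^sup>2))) > \<eta> * real M"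
  defines "\<delta> \<equiv> 2 / (\<eta>\<^sup>2 * real M)"
  shows "real (card {h\<in>{1..<M}. \<bar>2*\<theta>*real h - of_int (round (2*\<theta>*real h))\<bar> \<le> \<delta>}) \<ge> \<eta>\<^sup>2 * real M / 8"
proof -
  define G where "G = {h\<in>{1..<M}. \<bar>2*\<theta>*real h - of_int (round (2*\<theta>*real h))\<bar> \<le> \<delta>}"
  define g where "g h = norm (\<Sum>m=1..<M+1-h. cis (2*pi*(2*\<theta>*real h * real m)))" for h
  have M0: "real M > 0" using M eta by (smt (verit) divide_pos_pos zero_less_power)
  have d0: "\<delta> > 0" using eta M0 by (simp add: \<delta>_def)
  have "(\<eta> * real M)\<^sup>2 < real M + 2 * (\<Sum>h=1..<M. g h)"
    using weyl_differencing[of \<theta> M] power_strict_mono[OF S, of 2] eta M0 unfolding g_def by simp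
  also have "(\<Sum>h=1..<M. g h) \<le> (\<Sum>h=1..<M. (if h \<in> G then real M else 0) + \<eta>\<^sup>2 * real M / 4)"
  proof (rule sum_mono)
    fix h assume h: "h \<in> {1..<M}"
    show "g h \<le> (if h \<in> G then real M else 0) + \<eta>\<^sup>2 * real M / 4"
    proof (cases "h \<in> G")
      case True
      have "g h \<le> (\<Sum>m=1..<M+1-h. norm (cis (2*pi*(2*\<theta>*real h * real m))))" unfolding g_def by (rule norm_sum)
      also have "\<dots> \<le> real M" using h by simp
      finally have "g h \<le> real M" .
      moreover have "0 \<le> \<eta>\<^sup>2 * real M / 4" by simp
      ultimately have "g h \<le> real M + \<eta>\<^sup>2 * real M / 4" by linarith
      then show ?thesis using True by simp
    next
      case False
      then have "\<bar>2*\<theta>*real h - of_int (round (2*\<theta>*real h))\<bar> > \<delta>" using h by (auto simp: G_def)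
      from geometric_cis_bound[OF d0 this] have "g h \<le> 1 / (2 * \<delta>)" unfolding g_def .
      then show ?thesis using False eta M0 by (simp add: \<delta>_def)
    qed
  qed
  also have "\<dots> = real (card G) * real M + real (M - 1) * (\<eta>\<^sup>2 * real M / 4)"
  proof -
    have "{1..<M} \<inter> G = G" by (auto simp: G_def)
    then show ?thesis by (simp add: sum.distrib sum.If_cases)
  qed
  also have "\<dots> \<le> real (card G) * real M + real M * (\<eta>\<^sup>2 * real M / 4)"
    by (intro add_left_mono mult_right_mono) auto
  finally have "real M * (\<eta>\<^sup>2 * real M) < real M * (1 + 2 * real (card G) + \<eta>\<^sup>2 * real M / 2)"
    by (simp add: algebra_simps power2_eq_square)
  then have "\<eta>\<^sup>2 * real M < 1 + 2 * real (card G) + \<eta>\<^sup>2 * real M / 2" using M0 by (simp only: mult_less_cancel_left_pos)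
  moreover have "\<eta>\<^sup>2 * real M \<ge> 8" using M eta by (simp add: field_simps)
  ultimately show ?thesis unfolding G_def by simp
qed
text \<open>Two pigeonholes on the dense set \<open>G\<close> of good differences. Two nearby
  elements yield a bounded \<open>q\<close> with error O(1/M), which is one power of
  \<open>M\<close> short. A large part of \<open>G\<close> then has the same residue modulo
  \<open>q\<close> and the same integer offset; between its extremes, at distance of order
  \<open>M\<close>, the error accumulates about M/q times and is still only O(1/M), which forces it
  down to O(1/M^2).\<close>

lemma weyl_inverse:
  fixes \<eta> :: real
  assumes eta: "\<eta> > 0"
  shows "\<exists>C M0 :: nat. C \<ge> 1 \<and> (\<forall>M\<ge>M0. \<forall>\<theta>. norm (\<Sum>m=1..M. cis (2*pi*(\<theta> * (real m)\<^sup>2))) > \<eta> * real M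
    \<longrightarrow> (\<exists>q\<in>{1..C}. \<exists>p::int. \<bar>real q * \<theta> - of_int p\<bar> \<le> real C / (real M)\<^sup>2))"
proof -
  define T where "T = nat \<lceil>16 / \<eta>\<^sup>2\<rceil>"
  define K where "K = \<lceil>4 / \<eta>\<^sup>2\<rceil> + 2"
  define F where "F = real T * (2 * of_int K + 1)"
  define C where "C = max (2 * T) (nat \<lceil>64 * T * F / \<eta>^4\<rceil>)"
  define M0 where "M0 = nat \<lceil>max (32 / \<eta>\<^sup>2) (16 * F / \<eta>\<^sup>2)\<rceil> + 1"
  have e2: "\<eta>\<^sup>2 > 0" using eta by simp
  have T: "real T \<ge> 16 / \<eta>\<^sup>2" unfolding T_def by (rule real_nat_ceiling_ge)
  have T1: "T \<ge> 1" using T e2 by (metis One_nat_def Suc_leI divide_pos_pos not_le of_nat_0_less_iff order_less_le_trans zero_less_numeral)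
  have K: "real_of_int K \<ge> 4 / \<eta>\<^sup>2 + 2" unfolding K_def by simp
  have K0: "K \<ge> 2" proof -
    have "4 / \<eta>\<^sup>2 > 0" using e2 by simp
    then have "real_of_int K > 2" using K by linarith
    then show ?thesis by linarith
  qed
  have F0: "F > 0" using T1 K0 by (simp add: F_def)
  have "\<exists>q\<in>{1..C}. \<exists>p::int. \<bar>real q * \<theta> - of_int p\<bar> \<le> real C / (real M)\<^sup>2"
    if MM: "M \<ge> M0" and S: "norm (\<Sum>m=1..M. cis (2*pi*(\<theta> * (real m)\<^sup>2))) > \<eta> * real M" for M \<theta>
  proof -
    have "real M0 > max (32 / \<eta>\<^sup>2) (16 * F / \<eta>\<^sup>2)"
      unfolding M0_def using real_nat_ceiling_ge[of "max (32 / \<eta>\<^sup>2) (16 * F / \<eta>\<^sup>2)"] by simp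
    then have M: "real M > 32 / \<eta>\<^sup>2" "real M > 16 * F / \<eta>\<^sup>2" using MM by auto
    have M1: "real M > 0" using M(1) e2 by (meson divide_pos_pos less_trans zero_less_numeral)
    define \<delta> where "\<delta> = 2 / (\<eta>\<^sup>2 * real M)"
    define \<phi> where "\<phi> = 2 * \<theta>"
    define rn where "rn h = round (\<phi> * real h)" for h :: nat
    define G where "G = {h\<in>{1..<M}. \<bar>\<phi> * real h - of_int (rn h)\<bar> \<le> \<delta>}"
    have "8 / \<eta>\<^sup>2 \<le> 32 / \<eta>\<^sup>2" using e2 by (simp add: divide_right_mono)
    then have cG: "real (card G) \<ge> \<eta>\<^sup>2 * real M / 8"
      using many_good_differences[OF eta _ S] M(1) unfolding G_def rn_def \<phi>_def \<delta>_def by simp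
    have good: "\<bar>\<phi> * real h - of_int (rn h)\<bar> \<le> \<delta>" if "h \<in> G" for h using that by (simp add: G_def)
    have finG: "finite G" by (simp add: G_def)
    \<comment> \<open>\<open>G\<close> has density at least \<eta>^2/8 and blocks have length
      \<open>T\<close>, at least twice the inverse of that density, so there are fewer blocks than
      elements of \<open>G\<close>.\<close>
    have "\<not> inj_on (\<lambda>h. h div T) G"
    proof (rule pigeonhole)
      have "(\<lambda>h. h div T) ` G \<subseteq> {..M div T}" by (auto simp: G_def intro: div_le_mono)
      then have "card ((\<lambda>h. h div T) ` G) \<le> M div T + 1"
        using card_mono[of "{..M div T}"] by fastforce
      then have "real (card ((\<lambda>h. h div T) ` G)) \<le> real (M div T) + 1" by linarith
      also have "real (M div T) \<le> real M / real T" by (rule of_nat_div_le_of_nat)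
      also have "real M / real T \<le> real M / (16 / \<eta>\<^sup>2)" using T T1 e2 M1 by (intro divide_left_mono) auto
      also have "real M / (16 / \<eta>\<^sup>2) + 1 < \<eta>\<^sup>2 * real M / 8" using M(1) e2 by (simp add: field_simps)
      also have "\<dots> \<le> real (card G)" by (rule cG)
      finally show "card ((\<lambda>h. h div T) ` G) < card G" by simp
    qed
    then obtain a b where ab: "a \<in> G" "b \<in> G" "a < b" "a div T = b div T"
      unfolding inj_on_def by (metis linorder_neqE_nat)
    define q where "q = b - a"
    have q1: "q \<ge> 1" using ab by (simp add: q_def)
    have qT: "q \<le> T"
    proof -
      have "b = T * (b div T) + b mod T" "a = T * (a div T) + a mod T" by simp_all
      then have "b \<le> a + b mod T" using ab(4) by (metis add_le_mono1 le_add1)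
      moreover have "b mod T < T" using T1 by simp
      ultimately show ?thesis by (simp add: q_def)
    qed
    define p where "p = rn b - rn a"
    define \<kappa> where "\<kappa> = real q * \<phi> - of_int p"
    have "\<kappa> = (\<phi> * real b - of_int (rn b)) - (\<phi> * real a - of_int (rn a))"
      using ab(3) by (simp add: \<kappa>_def q_def p_def of_nat_diff algebra_simps)
    then have kap: "\<bar>\<kappa>\<bar> \<le> 2 * \<delta>" using good[OF ab(1)] good[OF ab(2)] by linarith
    have dM: "\<delta> * real M = 2 / \<eta>\<^sup>2" using M1 by (simp add: \<delta>_def)
    have d1: "0 < \<delta>" "\<delta> \<le> 1"
    proof -
      show "0 < \<delta>" using M1 e2 by (simp add: \<delta>_def)
      show "\<delta> \<le> 1" using M(1) M1 e2 by (simp add: \<delta>_def field_simps)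
    qed
    \<comment> \<open>The second component is the integer offset of \<open>h\<close> after removing
      the expected multiple of \<open>p\<close>. It equals a rounding error, the drift
      \<open>real (h div q) * \<kappa>\<close>, and a fractional part. The drift is at most
      2\<delta>M = 4/\<eta>^2 and the other two are at most 1 each, whence the choice of
      \<open>K\<close>.\<close>
    define \<Phi> where "\<Phi> h = (h mod q, rn h - int (h div q) * p - \<lfloor>\<phi> * real (h mod q)\<rfloor>)" for h
    have dec: "\<phi> * real h = \<phi> * real (h mod q) + real (h div q) * (\<kappa> + of_int p)" for h
    proof -
      have "real h = real (h mod q) + real q * real (h div q)"
        by (metis mod_mult_div_eq of_nat_add of_nat_mult)
      then show ?thesis by (simp add: \<kappa>_def algebra_simps)
    qed
    have maps: "\<Phi> \<in> G \<rightarrow> {..<T} \<times> {-K..K}"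
    proof
      fix h assume h: "h \<in> G"
      have "h mod q < T" using q1 qT by (metis less_le_trans mod_less_divisor zero_less_one order_less_le_trans)
      moreover have "rn h - int (h div q) * p - \<lfloor>\<phi> * real (h mod q)\<rfloor> \<in> {-K..K}"
      proof -
        have "\<bar>real (h div q) * \<kappa>\<bar> \<le> real M * (2 * \<delta>)"
        proof -
          have "h div q \<le> M" using h by (simp add: G_def) (meson div_le_dividend le_trans less_imp_le)
          then show ?thesis unfolding abs_mult using kap by (intro mult_mono) auto
        qed
        also have "\<dots> = 2 * (\<delta> * real M)" by simp
        also have "\<dots> = 4 / \<eta>\<^sup>2" unfolding dM by simp
        finally have 1: "\<bar>real (h div q) * \<kappa>\<bar> \<le> 4 / \<eta>\<^sup>2" .
        have "of_int (rn h - int (h div q) * p - \<lfloor>\<phi> * real (h mod q)\<rfloor>) =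
          (of_int (rn h) - \<phi> * real h) + real (h div q) * \<kappa> + (\<phi> * real (h mod q) - of_int \<lfloor>\<phi> * real (h mod q)\<rfloor>)"
          using dec[of h] by (simp add: algebra_simps)
        moreover have "0 \<le> \<phi> * real (h mod q) - of_int \<lfloor>\<phi> * real (h mod q)\<rfloor>" "\<phi> * real (h mod q) - of_int \<lfloor>\<phi> * real (h mod q)\<rfloor> \<le> 1"
          by (linarith)+
        ultimately have "\<bar>real_of_int (rn h - int (h div q) * p - \<lfloor>\<phi> * real (h mod q)\<rfloor>)\<bar> \<le> of_int K"
          using 1 good[OF h] d1 K by linarith
        then have "\<bar>rn h - int (h div q) * p - \<lfloor>\<phi> * real (h mod q)\<rfloor>\<bar> \<le> K" by linarith
        then show ?thesis by (simp add: abs_le_iff)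
      qed
      ultimately show "\<Phi> h \<in> {..<T} \<times> {-K..K}" by (simp add: \<Phi>_def)
    qed
    obtain z where z: "real (card (\<Phi> -` {z} \<inter> G)) * F \<ge> real (card G)"
    proof -
      have c: "card ({..<T} \<times> {-K..K}) = T * nat (2 * K + 1)" by (simp add: card_cartesian_product)
      obtain z where "z \<in> {..<T} \<times> {-K..K}" "card (\<Phi> -` {z} \<inter> G) * card ({..<T} \<times> {-K..K}) \<ge> card G"
      proof -
        have "{..<T} \<times> {-K..K} \<noteq> {}" using T1 K0 by (auto simp: lessThan_empty_iff)
        then show thesis using pigeonhole_card[OF maps finG] that by blast
      qed
      then have "real (card (\<Phi> -` {z} \<inter> G) * (T * nat (2 * K + 1))) \<ge> real (card G)" unfolding c by (simp only: of_nat_le_iff)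
      then show thesis using that[of z] K0 by (simp add: F_def)
    qed
    define Y where "Y = \<Phi> -` {z} \<inter> G"
    have finY: "finite Y" using finG by (simp add: Y_def)
    have cY: "real (card Y) * F \<ge> \<eta>\<^sup>2 * real M / 8" using z cG unfolding Y_def by linarith
    define c where "c = \<eta>\<^sup>2 * real M / (8 * F)"
    have cYc: "real (card Y) \<ge> c" using cY F0 by (simp add: c_def field_simps)
    have c2: "c \<ge> 2" using M(2) F0 e2 by (simp add: c_def field_simps)
    have Yne: "Y \<noteq> {}" using cYc c2 by auto
    \<comment> \<open>Taking the extremes turns the cardinality of \<open>Y\<close> into a distance:
      at least \<open>c - 1\<close>, hence at least \<open>c / 2\<close>.\<close>
    define u v where "u = Min Y" and "v = Max Y"
    have uv: "u \<in> Y" "v \<in> Y" using finY Yne by (auto simp: u_def v_def)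
    have sub: "Y \<subseteq> {u..v}" using finY by (auto simp: u_def v_def)
    have uv_le: "u \<le> v" using sub uv by auto
    have "card Y \<le> v + 1 - u" using card_mono[OF _ sub] by simp
    then have gap: "real v - real u \<ge> c - 1" using cYc uv_le by (simp add: of_nat_diff)
    have eqs: "u mod q = v mod q" "rn u - int (u div q) * p = rn v - int (v div q) * p"
      using uv by (auto simp: Y_def \<Phi>_def)
    have vu: "real v - real u = real q * (real (v div q) - real (u div q))"
    proof -
      have "real u = real (u mod q) + real q * real (u div q)" "real v = real (v mod q) + real q * real (v div q)"
        by (metis mod_mult_div_eq of_nat_add of_nat_mult)+
      then show ?thesis using eqs(1) by (simp add: algebra_simps)
    qed
    have "(real (v div q) - real (u div q)) * \<kappa> = (\<phi> * real v - of_int (rn v)) - (\<phi> * real u - of_int (rn u))"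
    proof -
      have "real_of_int (rn u) - real (u div q) * of_int p = of_int (rn v) - real (v div q) * of_int p"
        using arg_cong[OF eqs(2), of real_of_int] by simp
      then show ?thesis using dec[of u] dec[of v] eqs(1) by (simp add: algebra_simps)
    qed
    then have 2: "\<bar>(real (v div q) - real (u div q)) * \<kappa>\<bar> \<le> 2 * \<delta>"
      using good[of u] good[of v] uv by (simp add: Y_def)
    have "(c - 1) * \<bar>\<kappa>\<bar> \<le> (real v - real u) * \<bar>\<kappa>\<bar>" using gap by (intro mult_right_mono) auto
    also have "\<dots> = real q * \<bar>(real (v div q) - real (u div q)) * \<kappa>\<bar>"
    proof -
      have "real (v div q) - real (u div q) \<ge> 0" using uv_le by (simp add: div_le_mono)
      then show ?thesis unfolding vu by (simp add: abs_mult)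
    qed
    also have "\<dots> \<le> real T * (2 * \<delta>)" using 2 qT by (intro mult_mono) auto
    finally have 3: "(c - 1) * \<bar>\<kappa>\<bar> \<le> 2 * real T * \<delta>" by simp
    have "(c / 2) * \<bar>\<kappa>\<bar> \<le> (c - 1) * \<bar>\<kappa>\<bar>" using c2 by (intro mult_right_mono) auto
    with 3 have "(c / 2) * \<bar>\<kappa>\<bar> \<le> 2 * real T * \<delta>" by linarith
    then have "\<bar>\<kappa>\<bar> \<le> 4 * real T * \<delta> / c" using c2 by (simp add: field_simps)
    also have "\<dots> = (64 * T * F / \<eta>^4) / (real M)\<^sup>2"
      using e2 M1 F0 by (simp add: \<delta>_def c_def field_simps power2_eq_square power4_eq_xxxx)
    also have "\<dots> \<le> real C / (real M)\<^sup>2"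
    proof (rule divide_right_mono)
      have "64 * T * F / \<eta>^4 \<le> real (nat \<lceil>64 * T * F / \<eta>^4\<rceil>)" by (rule real_nat_ceiling_ge)
      also have "\<dots> \<le> real C" by (simp add: C_def)
      finally show "64 * T * F / \<eta>^4 \<le> real C" .
    qed simp
    finally have "\<bar>\<kappa>\<bar> \<le> real C / (real M)\<^sup>2" .
    \<comment> \<open>Differencing produced the frequency 2\<theta>, so the denominator for \<theta>
      is \<open>2 * q\<close>; this is why \<open>C\<close> is at least
      \<open>2 * T\<close>.\<close>
    moreover have "\<kappa> = real (2 * q) * \<theta> - of_int p" by (simp add: \<kappa>_def \<phi>_def)
    moreover have "2 * q \<in> {1..C}" using q1 qT by (auto simp: C_def)
    ultimately show ?thesis by metis
  qed
  moreover have "C \<ge> 1" using T1 by (simp add: C_def)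
  ultimately show ?thesis by blast
qed

section \<open>Passing to residue classes\<close>

text \<open>A solution is an \<open>m\<close> between sqrt n and sqrt(n + QH) whose residue modulo
  \<open>Q\<close> is one of the square roots of \<open>n\<close>. Each such residue class meets the
  interval in at least its length over \<open>Q\<close>, minus one, points, and \<open>h\<close> is
  determined by \<open>m\<close>.\<close>

lemma count_representations:
  fixes n Q H M :: nat
  assumes Q: "Q > 0" and n: "n > 0" and M: "n + Q * H \<le> M\<^sup>2"
  shows "real (card {(m, h) \<in> {1..M} \<times> {..<H}. m\<^sup>2 = n + Q * h}) \<ge>
    real (sqrt_count Q n) * ((sqrt (n + Q * H) - sqrt n) / Q - 1)"
proof -
  define R where "R = {c. c < Q \<and> [c\<^sup>2 = n] (mod Q)}"
  define lo where "lo c = nat \<lceil>(sqrt n - real c) / Q\<rceil>" for c :: nat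
  define hi where "hi c = nat \<lceil>(sqrt (n + Q * H) - real c) / Q\<rceil>" for c :: nat
  define \<phi> where "\<phi> = (\<lambda>(c, j). (c + Q * j, ((c + Q * j)\<^sup>2 - n) div Q))"
  define D where "D = (SIGMA c:R. {lo c..<hi c})"
  have finR: "finite R" by (simp add: R_def)
  have inj: "inj_on \<phi> D"
  proof (rule inj_onI)
    fix z z' assume z: "z \<in> D" "z' \<in> D" "\<phi> z = \<phi> z'"
    obtain c j c' j' where cj: "z = (c, j)" "z' = (c', j')" by (metis surj_pair)
    have e: "c + Q * j = c' + Q * j'" and l: "c < Q" "c' < Q" using z by (auto simp: cj \<phi>_def D_def R_def)
    have "c = (c + Q * j) mod Q" "c' = (c' + Q * j') mod Q" using l by simp_all
    then have "c = c'" using e by simp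
    then show "z = z'" using e Q by (simp add: cj)
  qed
  have img: "\<phi> ` D \<subseteq> {(m, h) \<in> {1..M} \<times> {..<H}. m\<^sup>2 = n + Q * h}"
  proof
    fix y assume "y \<in> \<phi> ` D"
    then obtain c j where c: "c \<in> R" and j: "lo c \<le> j" "j < hi c" and y: "y = \<phi> (c, j)" by (auto simp: D_def)
    define m where "m = c + Q * j"
    have "(sqrt n - real c) / Q \<le> real j" using j(1) unfolding lo_def by linarith
    then have "sqrt n \<le> real m" using Q by (simp add: m_def field_simps)
    then have "real n \<le> (real m)\<^sup>2" by (rule sqrt_le_D)
    then have nm: "n \<le> m\<^sup>2" by (metis of_nat_le_iff of_nat_power)
    have "real j < (sqrt (n + Q * H) - real c) / Q" using j(2) unfolding hi_def by linarith
    then have "real m < sqrt (n + Q * H)" using Q by (simp add: m_def field_simps)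
    then have "(real m)\<^sup>2 < real (n + Q * H)" by (metis not_le of_nat_0_le_iff real_le_lsqrt real_sqrt_ge_0_iff real_sqrt_le_iff real_sqrt_abs abs_of_nonneg real_le_rsqrt)
    then have mh: "m\<^sup>2 < n + Q * H" by (metis of_nat_less_iff of_nat_power)
    have "[m\<^sup>2 = c\<^sup>2] (mod Q)" unfolding m_def by (intro cong_pow) (simp add: cong_def)
    then have "[m\<^sup>2 = n] (mod Q)" using c by (auto simp: R_def intro: cong_trans)
    then have "Q dvd m\<^sup>2 - n" using nm by (simp add: cong_altdef_nat)
    then obtain h where h: "m\<^sup>2 = n + Q * h" using nm by (metis dvd_def le_add_diff_inverse)
    have "h < H" using mh h Q by simp
    moreover have "m \<ge> 1" using nm n by (cases m) auto
    moreover have "m \<le> M" using mh M by (metis less_imp_le order_less_le_trans power2_nat_le_eq_le)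
    moreover have "y = (m, h)" using h Q by (simp add: y \<phi>_def m_def[symmetric])
    ultimately show "y \<in> {(m, h) \<in> {1..M} \<times> {..<H}. m\<^sup>2 = n + Q * h}" using h by simp
  qed
  have each: "real (card {lo c..<hi c}) \<ge> (sqrt (n + Q * H) - sqrt n) / Q - 1" if "c \<in> R" for c
  proof -
    have cQ: "c < Q" using that by (simp add: R_def)
    \<comment> \<open>Since c < Q the quotient is above -1, so cutting \<open>lo\<close> off at zero
      still leaves it less than 1 above the quotient.\<close>
    have "- real Q < sqrt n - real c" using cQ real_sqrt_ge_zero[of n] by linarith
    then have "(sqrt n - real c) / Q > -1" using Q by (simp add: pos_less_divide_eq)
    then have "real (lo c) < (sqrt n - real c) / Q + 1" unfolding lo_def by linarith
    moreover have "real (hi c) \<ge> (sqrt (n + Q * H) - real c) / Q" unfolding hi_def by (rule real_nat_ceiling_ge)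
    moreover have "(sqrt (n + Q * H) - real c) / Q - (sqrt n - real c) / Q = (sqrt (n + Q * H) - sqrt n) / Q"
      by (simp add: diff_divide_distrib)
    ultimately have "real (hi c) - real (lo c) \<ge> (sqrt (n + Q * H) - sqrt n) / Q - 1" by linarith
    moreover have "real (card {lo c..<hi c}) \<ge> real (hi c) - real (lo c)" by simp
    ultimately show ?thesis by linarith
  qed
  have "real (sqrt_count Q n) * ((sqrt (n + Q * H) - sqrt n) / Q - 1) = (\<Sum>c\<in>R. (sqrt (n + Q * H) - sqrt n) / Q - 1)"
    by (simp add: sqrt_count_def R_def)
  also have "\<dots> \<le> (\<Sum>c\<in>R. real (card {lo c..<hi c}))" by (rule sum_mono) (rule each)
  also have "\<dots> = real (card D)" unfolding D_def using finR by (subst card_SigmaI) auto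
  also have "\<dots> \<le> real (card {(m, h) \<in> {1..M} \<times> {..<H}. m\<^sup>2 = n + Q * h})"
  proof -
    have "finite {(m, h) \<in> {1..M} \<times> {..<H}. m\<^sup>2 = n + Q * h}"
      by (rule finite_subset[of _ "{1..M} \<times> {..<H}"]) auto
    from card_inj_on_le[OF inj img this] show ?thesis by simp
  qed
  finally show ?thesis .
qed

text \<open>The kernel is the point mass at h = 0 minus the average over h < H of the shifted
  squares. Its transform is a Weyl sum times the average of 1 - e(-\<theta>Qh): either the first
  factor is small, or \<theta> is near a rational whose denominator divides \<open>Q\<close> and the
  second one is. The quantifiers matter: \<open>C\<close> depends on \<eta> alone, so that
  \<open>Q\<close> can be fixed before \<open>N\<close> grows.\<close>

lemma transference:
  fixes \<eta> :: real
  assumes eta: "\<eta> > 0" "\<eta> \<le> 1"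
  shows "\<exists>C::nat. \<forall>Q::nat. Q > 0 \<longrightarrow> (\<forall>q\<in>{1..C}. q dvd Q) \<longrightarrow> (\<exists>N0::nat. \<forall>N\<ge>N0. \<forall>A B. A \<subseteq> {1..N} \<longrightarrow> B \<subseteq> {1..N} \<longrightarrow>
    real (card {(a, b) \<in> A \<times> B. a + b \<in> pos_squares}) \<ge>
    (\<Sum>a\<in>A. \<Sum>b\<in>B. real (sqrt_count Q (a + b))) / (4 * sqrt N) - 2 * \<eta> * real N * sqrt N)"
proof -
  obtain C M0 :: nat where C1: "C \<ge> 1" and weyl: "\<And>M \<theta>. M \<ge> M0 \<Longrightarrow> norm (\<Sum>m=1..M. cis (2*pi*(\<theta> * (real m)\<^sup>2))) > \<eta>/2 * real M
    \<Longrightarrow> (\<exists>q\<in>{1..C}. \<exists>p::int. \<bar>real q * \<theta> - of_int p\<bar> \<le> real C / (real M)\<^sup>2)"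
  proof -
    have "\<eta>/2 > 0" using eta by simp
    from weyl_inverse[OF this] show thesis using that by blast
  qed
  have "real (card {(a, b) \<in> A \<times> B. a + b \<in> pos_squares}) \<ge>
    (\<Sum>a\<in>A. \<Sum>b\<in>B. real (sqrt_count Q (a + b))) / (4 * sqrt N) - 2 * \<eta> * real N * sqrt N"
    if Q: "Q > 0" and Qd: "\<forall>q\<in>{1..C}. q dvd Q" and NN: "N \<ge> nat \<lceil>(50 + 20 * (20 * real Q * C / \<eta>) + real M0)\<^sup>2\<rceil>"
      and A: "A \<subseteq> {1..N}" and B: "B \<subseteq> {1..N}" for Q N :: nat and A B
  proof -
    define s where "s = sqrt N"
    have ss: "s * s = real N" by (simp add: s_def)
    define g where "g = \<eta> / (20 * real Q * C)"
    have g0: "g > 0" using eta Q C1 by (simp add: g_def)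
    have "(50 + 20 * (20 * real Q * C / \<eta>) + real M0)\<^sup>2 \<le> real N"
      using NN by linarith
    then have "50 + 20 * (20 * real Q * C / \<eta>) + real M0 \<le> s" unfolding s_def by (rule real_le_rsqrt)
    moreover have "20 * real Q * C / \<eta> = 1 / g" by (simp add: g_def)
    moreover have "1 / g > 0" using g0 by simp
    moreover have "20 / g = 20 * (1 / g)" by simp
    ultimately have s: "s \<ge> 50" "s \<ge> 20 / g" "s \<ge> real M0 + 1" by linarith+
    have N0: "N > 0" using ss s(1) by (metis mult_eq_0_iff not_gr_zero not_numeral_le_zero of_nat_0)
    \<comment> \<open>Sums reach 2N and shifts add at most 3N/20; as M^2 \<ge> 2.9N, every
      \<open>n + Q * h\<close> that is a square has its root in range.\<close>
    define M where "M = nat \<lfloor>sqrt (3 * real N)\<rfloor>"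
    have M_le: "real M \<le> sqrt (3 * real N)" and M_gt: "real M + 1 > sqrt (3 * real N)"
    proof -
      have "\<lfloor>sqrt (3 * real N)\<rfloor> \<ge> 0" by simp
      then show "real M \<le> sqrt (3 * real N)" "real M + 1 > sqrt (3 * real N)" unfolding M_def by linarith+
    qed
    have M2_le: "(real M)\<^sup>2 \<le> 3 * real N"
    proof -
      have "(real M)\<^sup>2 \<le> (sqrt (3 * real N))\<^sup>2" by (intro power_mono M_le) simp
      then show ?thesis by simp
    qed
    have Ms: "real M \<le> 2 * s"
    proof (rule power2_le_imp_le)
      show "(real M)\<^sup>2 \<le> (2 * s)\<^sup>2" using M2_le ss by (simp add: power2_eq_square)
      show "0 \<le> 2 * s" using s by simp
    qed
    have M2_ge: "(real M)\<^sup>2 \<ge> 29/10 * real N"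
    proof -
      have "3 * real N = (sqrt (3 * real N))\<^sup>2" by simp
      also have "\<dots> \<le> (real M + 1)\<^sup>2" using M_gt by (intro power_mono) auto
      also have "\<dots> = (real M)\<^sup>2 + 2 * real M + 1" by (simp add: power2_eq_square algebra_simps)
      finally have 1: "3 * real N \<le> (real M)\<^sup>2 + 4 * s + 1" using Ms by linarith
      have "50 * s \<le> s * s" using s(1) by (intro mult_right_mono) auto
      then have "4 * s + 1 \<le> real N / 10" using ss s(1) by linarith
      then show ?thesis using 1 by linarith
    qed
    have MM0: "M \<ge> M0"
    proof -
      have "sqrt (real N) \<le> sqrt (3 * real N)" by simp
      then have "real M0 < real M + 1 " using M_gt s(3) unfolding s_def by linarith
      then show ?thesis by linarith
    qed
    have M0': "real M > 0" using M2_ge N0 by (cases "M = 0") auto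
    \<comment> \<open>\<open>g\<close> makes QHC/M^2 at most \<eta>/20, so on the major arcs
      Qh\<theta> stays within \<eta>/20 of an integer for all h < H; yet \<open>H\<close> has order
      N and in particular exceeds 36 sqrt N.\<close>
    define H where "H = nat \<lfloor>g * (real M)\<^sup>2\<rfloor>"
    have H_le: "real H \<le> g * (real M)\<^sup>2" unfolding H_def using g0 by (simp add: of_nat_floor)
    have H_ge: "real H \<ge> 36 * s"
    proof -
      have "20 \<le> g * s" using s(2) g0 by (simp add: field_simps)
      then have "20 * s \<le> g * s * s" using s(1) by (intro mult_right_mono) auto
      then have "20 * s \<le> g * real N" using ss by (simp add: mult.assoc)
      moreover have "g * (29/10 * real N) \<le> g * (real M)\<^sup>2" using M2_ge g0 by (intro mult_left_mono) auto
      moreover have "real H > g * (real M)\<^sup>2 - 1" unfolding H_def by linarith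
      ultimately show ?thesis using s(1) by (simp add: algebra_simps)
    qed
    have H0: "H > 0" "real H > 0" using H_ge s(1) by auto
    have QHC: "real Q * real H * real C / (real M)\<^sup>2 \<le> \<eta> / 20"
    proof -
      have "real Q * real H * real C \<le> real Q * (g * (real M)\<^sup>2) * real C"
        using H_le by (intro mult_right_mono mult_left_mono) auto
      also have "\<dots> = \<eta> / 20 * (real M)\<^sup>2" using Q C1 by (simp add: g_def)
      finally show ?thesis using M0' by (simp add: field_simps)
    qed
    have QH: "real Q * real H \<le> 3/20 * real N"
    proof -
      have "real Q * real H * 1 \<le> real Q * real H * real C" using C1 by (intro mult_left_mono) auto
      also have "\<dots> \<le> \<eta> / 20 * (real M)\<^sup>2" using QHC M0' by (simp add: field_simps)
      also have "\<dots> \<le> 1 / 20 * (3 * real N)" using eta M2_le by (intro mult_mono) auto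
      finally show ?thesis by simp
    qed
    \<comment> \<open>All differences \<open>a + b - t j\<close> are below 8N in absolute value, so
      congruence modulo \<open>L\<close> is equality.\<close>
    define L where "L = 8 * N"
    have L0: "L > 0" using N0 by (simp add: L_def)
    define J where "J = {1..M} \<times> {..<H}"
    define c where "c j = of_bool (snd j = 0) - 1 / real H" for j :: "nat \<times> nat"
    define t where "t j = int ((fst j)\<^sup>2) - int (Q * snd j)" for j :: "nat \<times> nat"
    have ker: "norm (\<Sum>j\<in>J. of_real (c j) * cis (2*pi*(real k * of_int (t j) / real L))) \<le> \<eta> * real M" for k
    proof -
      define \<theta> where "\<theta> = real k / real L"
      define S where "S = (\<Sum>m=1..M. cis (2*pi*(\<theta> * (real m)\<^sup>2)))"
      define E where "E h = cis (- (2*pi*(\<theta> * (real Q * real h))))" for h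
      have "(\<Sum>j\<in>J. of_real (c j) * cis (2*pi*(real k * of_int (t j) / real L))) =
         (\<Sum>m=1..M. \<Sum>h<H. cis (2*pi*(\<theta> * (real m)\<^sup>2)) * (of_real (of_bool (h = 0) - 1 / real H) * E h))"
        unfolding J_def sum.cartesian_product
      proof (rule sum.cong[OF refl])
        fix j assume "j \<in> {1..M} \<times> {..<H}"
        obtain m h where j: "j = (m, h)" by (metis surj_pair)
        have "cis (2*pi*(real k * of_int (t j) / real L)) = cis (2*pi*(\<theta> * (real m)\<^sup>2)) * E h"
          unfolding E_def cis_mult by (intro arg_cong[where f = cis]) (simp add: j t_def \<theta>_def algebra_simps diff_divide_distrib)
        then show "of_real (c j) * cis (2*pi*(real k * of_int (t j) / real L)) = (case j of (m, h) \<Rightarrow> cis (2*pi*(\<theta> * (real m)\<^sup>2)) * (of_real (of_bool (h = 0) - 1 / real H) * E h))"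
          by (simp add: j c_def)
      qed
      also have "\<dots> = S * (\<Sum>h<H. of_real (of_bool (h = 0) - 1 / real H) * E h)"
        by (simp only: S_def sum_product)
      also have "(\<Sum>h<H. of_real (of_bool (h = 0) - 1 / real H) * E h) = - (\<Sum>h<H. E h - 1) / of_nat H"
      proof -
        have "(\<Sum>h<H. of_real (of_bool (h = 0) - 1 / real H) * E h) = (\<Sum>h<H. if h = 0 then E h else 0) - (\<Sum>h<H. E h / of_nat H)"
          unfolding sum_subtractf[symmetric] by (intro sum.cong refl) (simp add: algebra_simps)
        also have "(\<Sum>h<H. if h = 0 then E h else 0) = 1" using H0 by (simp add: E_def)
        finally show ?thesis using H0 by (simp add: sum_subtractf sum_divide_distrib[symmetric] field_simps)
      qed
      finally have eq: "norm (\<Sum>j\<in>J. of_real (c j) * cis (2*pi*(real k * of_int (t j) / real L))) = norm S * (norm (\<Sum>h<H. E h - 1) / real H)"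
        by (simp add: norm_mult norm_divide)
      have avg: "norm (\<Sum>h<H. E h - 1) / real H \<le> z" if "\<And>h. h < H \<Longrightarrow> norm (E h - 1) \<le> z" for z
      proof -
        have "norm (\<Sum>h<H. E h - 1) \<le> (\<Sum>h<H. norm (E h - 1))" by (rule norm_sum)
        also have "\<dots> \<le> real H * z" using sum_bounded_above[of "{..<H}" "\<lambda>h. norm (E h - 1)" z] that by simp
        finally show ?thesis using H0 by (simp add: field_simps)
      qed
      have avg0: "0 \<le> norm (\<Sum>h<H. E h - 1) / real H" by simp
      have SM: "norm S \<le> real M"
        using norm_sum[of "\<lambda>m. cis (2*pi*(\<theta> * (real m)\<^sup>2))" "{1..M}"] by (simp add: S_def)
      \<comment> \<open>The threshold \<eta>/2 balances the cases: a small Weyl sum meets the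
        trivial bound 2 for the other factor, a large one the trivial bound \<open>M\<close> and the
        factor \<eta>.\<close>
      show ?thesis
      proof (cases "norm S > \<eta>/2 * real M")
        case False
        have "norm (E h - 1) \<le> 2" for h using norm_triangle_ineq4[of "E h" 1] by (simp add: E_def)
        then have "norm S * (norm (\<Sum>h<H. E h - 1) / real H) \<le> (\<eta>/2 * real M) * 2"
          using False avg[of 2] avg0 eta by (intro mult_mono) auto
        then show ?thesis unfolding eq by simp
      next
        case True
        then obtain q p where q: "q \<in> {1..C}" and p: "\<bar>real q * \<theta> - of_int p\<bar> \<le> real C / (real M)\<^sup>2"
          using weyl[OF MM0] unfolding S_def by blast
        obtain w where w: "Q = q * w" using Qd q by (meson dvdE)
        have wQ: "w \<le> Q" using q by (simp add: w)
        have "norm (E h - 1) \<le> \<eta>" if h: "h < H" for h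
        proof -
          define x where "x = - (2 * pi * (real w * real h * (real q * \<theta> - of_int p)))"
          have "E h = cis x * cis (2 * pi * of_int (- (int w * int h * p)))"
            unfolding E_def cis_mult by (intro arg_cong[where f = cis]) (simp add: x_def w algebra_simps)
          also have "cis (2 * pi * of_int (- (int w * int h * p))) = 1" by (intro cis_multiple_2pi Ints_of_int)
          finally have "norm (E h - 1) \<le> \<bar>x\<bar>" using norm_cis_minus_one_le[of x] by simp
          also have "\<dots> = 2 * pi * (real w * real h * \<bar>real q * \<theta> - of_int p\<bar>)" by (simp add: x_def abs_mult)
          also have "\<dots> \<le> 2 * pi * (real Q * real H * (real C / (real M)\<^sup>2))"
            using p wQ h by (intro mult_left_mono mult_mono) auto
          also have "\<dots> \<le> 2 * pi * (\<eta> / 20)" using QHC by (intro mult_left_mono) auto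
          also have "\<dots> \<le> \<eta>" using pi_less_4 eta by (simp add: field_simps)
          finally show ?thesis .
        qed
        then have "norm S * (norm (\<Sum>h<H. E h - 1) / real H) \<le> real M * \<eta>"
          using SM avg avg0 by (intro mult_mono) auto
        then show ?thesis unfolding eq by (simp add: mult.commute)
      qed
    qed
    have finA: "finite A" "finite B" using A B finite_subset by auto
    have AL: "A \<subseteq> {..<L}" "B \<subseteq> {..<L}" using A B N0 by (auto simp: L_def)
    have rng: "real (a + b) \<le> 2 * real N" "a + b > 0" if "a \<in> A" "b \<in> B" for a b
      using that A B by (auto simp: subset_iff) (smt (verit) of_nat_mono atLeastAtMost_iff of_nat_le_iff)
    have cnt: "(\<Sum>a<L. \<Sum>b<L. if int L dvd int a + int b - t j then indicator A a * indicator B b else 0)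
       = (\<Sum>a\<in>A. \<Sum>b\<in>B. of_bool (int (a + b) = t j) :: real)" if j: "j \<in> J" for j
    proof -
      have "(\<Sum>a\<in>A. \<Sum>b\<in>B. of_bool (int (a + b) = t j) :: real) = (\<Sum>a\<in>A. \<Sum>b\<in>B. of_bool (int L dvd int a + int b - t j))"
      proof (intro sum.cong refl arg_cong[where f = of_bool])
        fix a b assume ab: "a \<in> A" "b \<in> B"
        obtain m h where mh: "j = (m, h)" "m \<le> M" "h < H" using j by (auto simp: J_def)
        have "(real m)\<^sup>2 \<le> 3 * real N" using M2_le power_mono[of "real m" "real M" 2] mh by linarith
        moreover have "real Q * real h \<le> 3/20 * real N"
          using QH mh by (smt (verit) mult_left_mono of_nat_0_le_iff of_nat_less_iff)
        moreover have "real_of_int (t j) = (real m)\<^sup>2 - real Q * real h" by (simp add: t_def mh)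
        moreover have "0 \<le> real Q * real h" "0 \<le> (real m)\<^sup>2" by simp_all
        moreover have "real N > 0" "real a + real b \<le> 2 * real N" "real a + real b \<ge> 0" using N0 rng[OF ab] by auto
        ultimately have "\<bar>real_of_int (int a + int b - t j)\<bar> < 8 * real N"
          unfolding of_int_diff of_int_add of_int_of_nat_eq by linarith
        then have "\<bar>int a + int b - t j\<bar> < int L" by (simp add: L_def)
        then show "(int (a + b) = t j) = (int L dvd int a + int b - t j)"
          using dvd_imp_le_int[of "int a + int b - t j" "int L"] by fastforce
      qed
      also have "\<dots> = (\<Sum>a<L. indicator A a * (\<Sum>b<L. indicator B b * of_bool (int L dvd int a + int b - t j)))"
        by (simp only: sum_eq_sum_indicator[OF AL(1)] sum_eq_sum_indicator[OF AL(2)])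
      also have "\<dots> = (\<Sum>a<L. \<Sum>b<L. if int L dvd int a + int b - t j then indicator A a * indicator B b else 0)"
        unfolding sum_distrib_left by (intro sum.cong refl) simp
      finally show ?thesis by simp
    qed
    define P where "P = (\<Sum>j\<in>J. c j * (\<Sum>a<L. \<Sum>b<L. if int L dvd int a + int b - t j then indicator A a * indicator B b else 0))"
    have sq: "(\<Sum>a<L. (indicator U a :: real)\<^sup>2) \<le> real N" if "U \<subseteq> {1..N}" "U \<subseteq> {..<L}" for U
    proof -
      have "(\<Sum>a<L. (indicator U a :: real)\<^sup>2) = real (card U)"
        using sum_eq_sum_indicator[OF that(2), of "\<lambda>_. 1"] by (simp add: power2_eq_square indicator_def)
      also have "\<dots> \<le> real N" using card_mono[OF _ that(1)] by simp
      finally show ?thesis .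
    qed
    have "\<bar>P\<bar> \<le> \<eta> * real M * sqrt (\<Sum>a<L. (indicator A a)\<^sup>2) * sqrt (\<Sum>b<L. (indicator B b)\<^sup>2)"
      unfolding P_def by (rule bilinear_fourier_bound[OF L0 _ ker]) (simp add: J_def)
    also have "\<dots> \<le> \<eta> * (2 * s) * s * s"
      using sq[OF A AL(1)] sq[OF B AL(2)] Ms eta s(1) unfolding s_def
      by (intro mult_mono real_sqrt_le_mono) (auto intro!: mult_nonneg_nonneg sum_nonneg)
    also have "\<dots> = 2 * \<eta> * (s * s) * s" by simp
    also have "\<dots> = 2 * \<eta> * real N * s" by (simp only: ss)
    finally have P: "P \<ge> - (2 * \<eta> * real N * s)" by linarith
    have "P = (\<Sum>j\<in>J. \<Sum>a\<in>A. \<Sum>b\<in>B. c j * of_bool (int (a + b) = t j))"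
      unfolding P_def by (intro sum.cong refl) (simp add: cnt sum_distrib_left)
    also have "\<dots> = (\<Sum>a\<in>A. \<Sum>b\<in>B. \<Sum>j\<in>J. c j * of_bool (int (a + b) = t j))"
      by (subst sum.swap, rule sum.cong[OF refl], rule sum.swap)
    also have "\<dots> \<le> (\<Sum>a\<in>A. \<Sum>b\<in>B. of_bool (a + b \<in> pos_squares) - real (sqrt_count Q (a + b)) / (4 * s))"
    proof (intro sum_mono)
      fix a b assume ab: "a \<in> A" "b \<in> B"
      define n where "n = a + b"
      have n: "real n \<le> 2 * real N" "n > 0" using rng[OF ab] by (auto simp: n_def)
      have "real (n + Q * H) \<le> real (M\<^sup>2)" using n QH M2_ge by simp
      then have nQH: "n + Q * H \<le> M\<^sup>2" by (simp only: of_nat_le_iff)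
      have "(\<Sum>j\<in>J. c j * of_bool (int n = t j)) =
         (\<Sum>j\<in>J. of_bool (snd j = 0 \<and> int n = t j)) - (1 / real H) * (\<Sum>j\<in>J. of_bool (int n = t j))"
        unfolding sum_distrib_left sum_subtractf[symmetric] by (intro sum.cong refl) (simp add: c_def)
      also have "(\<Sum>j\<in>J. of_bool (snd j = 0 \<and> int n = t j)) = (of_bool (n \<in> pos_squares) :: real)"
      proof (cases "n \<in> pos_squares")
        case True
        then obtain m where m: "n = m\<^sup>2" "m \<ge> 1" by (auto simp: pos_squares_def)
        have "m\<^sup>2 \<le> M\<^sup>2" using nQH m(1) by (metis add_leD1)
        then have "m \<le> M" by (simp add: power2_nat_le_eq_le)
        then have "J \<inter> {j. snd j = 0 \<and> int n = t j} = {(m, 0)}" using m H0 by (auto simp: J_def t_def power2_eq_iff_nonneg simp flip: of_nat_power)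
        then show ?thesis using True by (simp add: J_def of_bool_def sum.If_cases)
      next
        case False
        have "\<not> (snd j = 0 \<and> int n = t j)" if "j \<in> J" for j
        proof
          assume "snd j = 0 \<and> int n = t j"
          then have "int n = int ((fst j)\<^sup>2)" by (simp add: t_def)
          then have "n = (fst j)\<^sup>2" by (simp only: of_nat_eq_iff)
          then show False using False that by (auto simp: pos_squares_def J_def)
        qed
        then show ?thesis using False by (simp add: sum.neutral)
      qed
      also have "(\<Sum>j\<in>J. of_bool (int n = t j)) = real (card {(m, h) \<in> {1..M} \<times> {..<H}. m\<^sup>2 = n + Q * h})"
      proof -
        have "J \<inter> {j. int n = t j} = {(m, h) \<in> {1..M} \<times> {..<H}. m\<^sup>2 = n + Q * h}"
          unfolding J_def t_def by (auto simp flip: of_nat_power of_nat_mult of_nat_add simp: algebra_simps)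
        then show ?thesis by (simp add: J_def of_bool_def sum.If_cases)
      qed
      finally have 1: "(\<Sum>j\<in>J. c j * of_bool (int n = t j)) = of_bool (n \<in> pos_squares) - (1 / real H) * real (card {(m, h) \<in> {1..M} \<times> {..<H}. m\<^sup>2 = n + Q * h})" .
      have "real (sqrt_count Q n) / (4 * s) \<le> (1 / real H) * (real (sqrt_count Q n) * ((sqrt (n + Q * H) - sqrt n) / Q - 1))"
      proof -
        have x2: "sqrt (n + Q * H) \<le> 9/5 * s" 
        proof (rule real_le_lsqrt)
          show "0 \<le> 9/5 * s" using s(1) by simp
          have "real (n + Q * H) \<le> 3 * real N" using n QH N0 by simp
          then show "real (n + Q * H) \<le> (9/5 * s)\<^sup>2" using ss by (simp add: power2_eq_square)
        qed
        have x1: "sqrt n \<le> sqrt (n + Q * H)" by simp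
        have "real Q * real H = (sqrt (n + Q * H))\<^sup>2 - (sqrt n)\<^sup>2" by simp
        also have "\<dots> = (sqrt (n + Q * H) - sqrt n) * (sqrt (n + Q * H) + sqrt n)" by (simp add: power2_eq_square algebra_simps)
        also have "\<dots> \<le> (sqrt (n + Q * H) - sqrt n) * (18/5 * s)"
        proof (rule mult_left_mono)
          show "sqrt (n + Q * H) + sqrt n \<le> 18/5 * s" using x1 x2 by linarith
        qed (use x1 in simp)
        finally have "real H / (18/5 * s) \<le> (sqrt (n + Q * H) - sqrt n) / Q" using Q s(1) by (simp add: field_simps)
        \<comment> \<open>Replacing 18/5 by 4 leaves H/(36s), which is at least 1 and pays for the
          \<open>- 1\<close> from the interval ends.\<close>
        then have "1 / (4 * s) * real H \<le> (sqrt (n + Q * H) - sqrt n) / Q - 1"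
        proof -
          have "real H / (18/5 * s) - 1 / (4 * s) * real H = real H / (36 * s)" by (simp add: field_simps)
          moreover have "real H / (36 * s) \<ge> 1" using H_ge s(1) by (simp add: field_simps)
          ultimately show ?thesis using \<open>real H / (18/5 * s) \<le> (sqrt (n + Q * H) - sqrt n) / Q\<close> by linarith
        qed
        then have "1 / (4 * s) \<le> (1 / real H) * ((sqrt (n + Q * H) - sqrt n) / Q - 1)" using H0 by (simp add: field_simps)
        from mult_left_mono[OF this, of "real (sqrt_count Q n)"] show ?thesis by (simp add: mult_ac)
      qed
      also have "\<dots> \<le> (1 / real H) * real (card {(m, h) \<in> {1..M} \<times> {..<H}. m\<^sup>2 = n + Q * h})"
        by (intro mult_left_mono count_representations[OF Q n(2) nQH]) simp
      finally show "(\<Sum>j\<in>J. c j * of_bool (int (a + b) = t j)) \<le> of_bool (a + b \<in> pos_squares) - real (sqrt_count Q (a + b)) / (4 * s)"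
        using 1 unfolding n_def by linarith
    qed
    also have "\<dots> = real (card {(a, b) \<in> A \<times> B. a + b \<in> pos_squares}) - (\<Sum>a\<in>A. \<Sum>b\<in>B. real (sqrt_count Q (a + b))) / (4 * s)"
    proof -
      have "(\<Sum>a\<in>A. \<Sum>b\<in>B. of_bool (a + b \<in> pos_squares)) = (\<Sum>z\<in>A \<times> B. of_bool (fst z + snd z \<in> pos_squares) :: real)"
        unfolding sum.cartesian_product by (simp add: case_prod_unfold)
      also have "\<dots> = real (card ((A \<times> B) \<inter> {z. fst z + snd z \<in> pos_squares}))"
        using finA by (simp add: of_bool_def sum.If_cases)
      also have "(A \<times> B) \<inter> {z. fst z + snd z \<in> pos_squares} = {(a, b) \<in> A \<times> B. a + b \<in> pos_squares}" by auto
      finally show ?thesis by (simp add: sum_subtractf sum_divide_distrib)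
    qed
    finally show ?thesis using P unfolding s_def by linarith
  qed
  then show ?thesis by blast
qed

section \<open>The main term\<close>

lemma square_root_mod_two_power:
  fixes n :: int
  assumes n: "n mod 8 = 1" and k: "k \<ge> 3"
  shows "\<exists>c. odd c \<and> 2 ^ k dvd c\<^sup>2 - n"
  using k
proof (induction k rule: dec_induct)
  case base
  have "2 ^ 3 dvd 1\<^sup>2 - n" using n by (simp add: mod_eq_dvd_iff[symmetric])
  then show ?case by (intro exI[of _ 1]) simp
next
  case (step k)
  then obtain c t where c: "odd c" "c\<^sup>2 - n = 2 ^ k * t" by (auto elim!: dvdE)
  show ?case
  proof (cases "even t")
    case True
    then obtain t' where "t = 2 * t'" by (auto elim: evenE)
    then have "c\<^sup>2 - n = 2 ^ Suc k * t'" using c by simp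
    then show ?thesis using c(1) by (metis dvd_triv_left)
  next
    case False
    obtain l where l: "k = Suc (Suc (Suc l))" using step.hyps by (metis Suc_le_D numeral_3_eq_3 le_Suc_ex add_Suc add_0)
    \<comment> \<open>The shift changes c^2 by 2^k c modulo 2^(k+1), and c is odd, so it makes the
      odd quotient \<open>t\<close> even. The square of the shift is harmless because 2k - 2 \<ge> k
      + 1 for k \<ge> 3.\<close>
    define c' where "c' = c + 2 ^ (k - 1)"
    have "even (t + c)" using False c(1) by simp
    then obtain w where w: "t + c = 2 * w" by (blast elim: evenE)
    define y :: int where "y = 2 ^ l"
    have y: "2 ^ k = 8 * y" "2 ^ (k - 1) = 4 * y" "2 ^ Suc k = 16 * y" by (simp_all add: l y_def)
    have "c'\<^sup>2 - n = (c\<^sup>2 - n) + 8 * y * c + 16 * y * y"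
      unfolding c'_def y by (simp add: power2_eq_square algebra_simps)
    also have "\<dots> = 8 * y * (t + c) + 16 * y * y" unfolding c(2) y by (simp add: algebra_simps)
    also have "\<dots> = 2 ^ Suc k * (w + y)" unfolding w y by (simp add: algebra_simps)
    finally have "2 ^ Suc k dvd c'\<^sup>2 - n" by (metis dvd_triv_left)
    moreover have "odd c'" using c(1) by (simp add: c'_def l)
    ultimately show ?thesis by blast
  qed
qed

lemma sqrt_count_two_power_pos:
  assumes n: "n mod 8 = 1" and k: "k \<ge> 3"
  shows "sqrt_count (2 ^ k) n \<ge> 1"
proof -
  have "int n mod 8 = 1" using n by (metis of_nat_1 of_nat_numeral zmod_int)
  from square_root_mod_two_power[OF this k] obtain c where c: "2 ^ k dvd c\<^sup>2 - int n" by blast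
  define m where "m = nat (c mod 2 ^ k)"
  have m: "int m = c mod 2 ^ k" by (simp add: m_def)
  have "[int m = c] (mod 2 ^ k)" by (simp add: m cong_def)
  then have "[(int m)\<^sup>2 = c\<^sup>2] (mod 2 ^ k)" by (rule cong_pow)
  also have "[c\<^sup>2 = int n] (mod 2 ^ k)" using c by (simp add: cong_iff_dvd_diff)
  finally have "[int (m\<^sup>2) = int n] (mod int (2 ^ k))" by simp
  then have "[m\<^sup>2 = n] (mod 2 ^ k)" by (simp only: cong_int_iff)
  moreover have "m < 2 ^ k"
  proof -
    have "int m < 2 ^ k" unfolding m by simp
    then show ?thesis by (metis of_nat_less_iff of_nat_numeral of_nat_power)
  qed
  ultimately have "m \<in> {m. m < 2 ^ k \<and> [m\<^sup>2 = n] (mod 2 ^ k)}" by simp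
  then have "card {m. m < 2 ^ k \<and> [m\<^sup>2 = n] (mod 2 ^ k)} > 0" by (subst card_gt_0_iff) auto
  then show ?thesis by (simp add: sqrt_count_def)
qed

lemma sqrt_count_mult:
  assumes cop: "coprime P q" and pos: "P > 0" "q > 0"
  shows "sqrt_count P n * sqrt_count q n \<le> sqrt_count (P * q) n"
proof -
  let ?R = "\<lambda>q. {m. m < q \<and> [m\<^sup>2 = n] (mod q)}"
  have ex: "\<exists>c. c < P * q \<and> [c = fst z] (mod P) \<and> [c = snd z] (mod q)" for z
    using binary_chinese_remainder_unique_nat[OF cop, of "fst z" "snd z"] pos by blast
  define \<phi> where "\<phi> z = (SOME c. c < P * q \<and> [c = fst z] (mod P) \<and> [c = snd z] (mod q))" for z
  have phi: "\<phi> z < P * q" "[\<phi> z = fst z] (mod P)" "[\<phi> z = snd z] (mod q)" for z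
    using someI_ex[OF ex[of z]] unfolding \<phi>_def by blast+
  have "card (?R P \<times> ?R q) \<le> card (?R (P * q))"
  proof (rule card_inj_on_le)
    show "inj_on \<phi> (?R P \<times> ?R q)"
    proof (rule inj_onI)
      fix y z assume yz: "y \<in> ?R P \<times> ?R q" "z \<in> ?R P \<times> ?R q" "\<phi> y = \<phi> z"
      have "[fst y = fst z] (mod P)" "[snd y = snd z] (mod q)"
        using phi[of y] phi[of z] yz(3) by (metis cong_sym cong_trans)+
      then have "fst y = fst z" "snd y = snd z" using yz(1,2)
        cong_less_modulus_unique_nat[of "fst y" "fst z" P] cong_less_modulus_unique_nat[of "snd y" "snd z" q] by auto
      then show "y = z" by (rule prod_eqI)
    qed
    show "\<phi> ` (?R P \<times> ?R q) \<subseteq> ?R (P * q)"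
    proof
      fix c assume "c \<in> \<phi> ` (?R P \<times> ?R q)"
      then obtain z where z: "c = \<phi> z" "z \<in> ?R P \<times> ?R q" by auto
      have "[c\<^sup>2 = n] (mod P)" "[c\<^sup>2 = n] (mod q)"
        using z phi[of z] cong_pow[of "\<phi> z" "fst z" P 2] cong_pow[of "\<phi> z" "snd z" q 2] by (auto intro: cong_trans)
      then have "[c\<^sup>2 = n] (mod P * q)" using cop by (simp add: coprime_cong_mult_nat)
      then show "c \<in> ?R (P * q)" using phi z by simp
    qed
  qed simp
  then show ?thesis by (simp add: sqrt_count_def card_cartesian_product)
qed

lemma card_residue_class_lessThan:
  fixes d c r :: nat
  assumes "r < d"
  shows "card {i. i < d * c \<and> i mod d = r} = c"
proof -
  have "{i. i < d * c \<and> i mod d = r} = (\<lambda>j. r + d * j) ` {..<c}"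
  proof (intro equalityI subsetI)
    fix i assume i: "i \<in> {i. i < d * c \<and> i mod d = r}"
    have "i div d < c" using i assms by (simp add: less_mult_imp_div_less mult.commute)
    moreover have "i = r + d * (i div d)" using i by auto
    ultimately show "i \<in> (\<lambda>j. r + d * j) ` {..<c}" by blast
  next
    fix i assume "i \<in> (\<lambda>j. r + d * j) ` {..<c}"
    then obtain j where j: "i = r + d * j" "j < c" by auto
    have "r + d * j < d * (j + 1)" using assms by simp
    also have "\<dots> \<le> d * c" using j by (intro mult_left_mono) auto
    finally show "i \<in> {i. i < d * c \<and> i mod d = r}" using j assms by simp
  qed
  moreover have "inj_on (\<lambda>j. r + d * j) {..<c}" using assms by (auto simp: inj_on_def)
  ultimately show ?thesis by (simp add: card_image)
qed

text \<open>Each \<open>m\<close> has exactly one partner \<open>j\<close> with m^2 = i + j modulo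
  \<open>P\<close>, and its class modulo 8 is read off from m^2. The result depends only on
  \<open>i\<close> modulo 8, so the graph between two classes modulo 8 is regular.\<close>

lemma sum_sqrt_count_class:
  fixes P i s :: nat
  assumes P: "8 dvd P" "P > 0" and s: "s < 8"
  shows "(\<Sum>j | j < P \<and> j mod 8 = s. sqrt_count P (i + j)) = card {m. m < P \<and> m\<^sup>2 mod 8 = (i + s) mod 8}"
proof -
  let ?C = "{j. j < P \<and> j mod 8 = s}"
  have "(\<Sum>j\<in>?C. sqrt_count P (i + j)) = (\<Sum>j\<in>?C. \<Sum>m<P. of_bool ([m\<^sup>2 = i + j] (mod P)))"
  proof (rule sum.cong[OF refl])
    fix j
    have "{..<P} \<inter> {m. [m\<^sup>2 = i + j] (mod P)} = {m. m < P \<and> [m\<^sup>2 = i + j] (mod P)}" by auto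
    then show "sqrt_count P (i + j) = (\<Sum>m<P. of_bool ([m\<^sup>2 = i + j] (mod P)))"
      by (simp add: sqrt_count_def of_bool_def sum.If_cases)
  qed
  also have "\<dots> = (\<Sum>m<P. \<Sum>j\<in>?C. of_bool ([m\<^sup>2 = i + j] (mod P)))" by (rule sum.swap)
  also have "\<dots> = (\<Sum>m<P. of_bool (m\<^sup>2 mod 8 = (i + s) mod 8))"
  proof (rule sum.cong[OF refl])
    fix m
    define j0 where "j0 = (m\<^sup>2 + (P - i mod P)) mod P"
    have j0: "j0 < P" using P by (simp add: j0_def)
    have ij0: "[m\<^sup>2 = i + j0] (mod P)"
    proof -
      have "[i + j0 = i + (m\<^sup>2 + (P - i mod P))] (mod P)" unfolding j0_def by (intro cong_add cong_refl) (simp add: cong_def)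
      also have "[i + (m\<^sup>2 + (P - i mod P)) = i mod P + (m\<^sup>2 + (P - i mod P))] (mod P)" by (intro cong_add cong_refl) (simp add: cong_def)
      also have "i mod P + (m\<^sup>2 + (P - i mod P)) = m\<^sup>2 + P"
        using mod_less_divisor[OF P(2), of i] by linarith
      also have "[m\<^sup>2 + P = m\<^sup>2] (mod P)" by (simp add: cong_def)
      finally show ?thesis by (rule cong_sym)
    qed
    have uniq: "[m\<^sup>2 = i + j] (mod P) \<longleftrightarrow> j = j0" if "j < P" for j
      using ij0 that j0 by (metis cong_add_lcancel_nat cong_less_modulus_unique_nat cong_sym cong_trans)
    have m8: "m\<^sup>2 mod 8 = (i + s) mod 8 \<longleftrightarrow> j0 mod 8 = s"
    proof -
      have "[m\<^sup>2 = i + j0] (mod 8)" using ij0 P(1) by (rule cong_dvd_modulus_nat)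
      then have "m\<^sup>2 mod 8 = (i + s) mod 8 \<longleftrightarrow> [i + j0 = i + s] (mod 8)" by (simp add: cong_def)
      also have "\<dots> \<longleftrightarrow> j0 mod 8 = s" unfolding cong_add_lcancel_nat using s by (simp add: cong_def)
      finally show ?thesis .
    qed
    have "?C \<inter> {j. [m\<^sup>2 = i + j] (mod P)} = (if j0 mod 8 = s then {j0} else {})" using uniq j0 by auto
    then show "(\<Sum>j\<in>?C. of_bool ([m\<^sup>2 = i + j] (mod P))) = (of_bool (m\<^sup>2 mod 8 = (i + s) mod 8) :: nat)"
      unfolding m8 by (simp add: of_bool_def sum.If_cases)
  qed
  also have "\<dots> = card {m. m < P \<and> m\<^sup>2 mod 8 = (i + s) mod 8}"
  proof -
    have "{..<P} \<inter> {m. m\<^sup>2 mod 8 = (i + s) mod 8} = {m. m < P \<and> m\<^sup>2 mod 8 = (i + s) mod 8}" by auto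
    then show ?thesis by (simp add: of_bool_def sum.If_cases)
  qed
  finally show ?thesis .
qed

lemma card_even_roots_mod8:
  fixes c n :: nat
  assumes n: "n mod 4 = 0"
  shows "card {m. m < 8 * c \<and> m\<^sup>2 mod 8 = n mod 8} \<ge> 2 * c"
proof -
  define r where "r = (if n mod 8 = 0 then 0 else 2 :: nat)"
  have n8: "n mod 8 = 0 \<or> n mod 8 = 4" using n by presburger
  have "{m. m < 4 * (2 * c) \<and> m mod 4 = r} \<subseteq> {m. m < 8 * c \<and> m\<^sup>2 mod 8 = n mod 8}"
  proof
    fix m assume m: "m \<in> {m. m < 4 * (2 * c) \<and> m mod 4 = r}"
    obtain j where j: "m = r + 4 * j" using m by (metis (mono_tags, lifting) mem_Collect_eq mod_mult_div_eq)
    have "m\<^sup>2 = r\<^sup>2 + 8 * (r * j + 2 * j\<^sup>2)" by (simp add: j power2_eq_square algebra_simps)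
    then have "m\<^sup>2 mod 8 = r\<^sup>2 mod 8" by (simp only: mod_mult_self2)
    then show "m \<in> {m. m < 8 * c \<and> m\<^sup>2 mod 8 = n mod 8}" using m n8 by (auto simp: r_def)
  qed
  then have "card {m. m < 4 * (2 * c) \<and> m mod 4 = r} \<le> card {m. m < 8 * c \<and> m\<^sup>2 mod 8 = n mod 8}"
    by (intro card_mono) auto
  then show ?thesis using card_residue_class_lessThan[of r 4 "2 * c"] by (simp add: r_def split: if_splits)
qed

text \<open>In the odd case every pair from the two classes has a common root count of at least 1,
  so the product of the masses is a lower bound. In the even case the graph between the classes is
  regular of degree \<open>D\<close>, at least twice the class size c, and
  \<open>f i * h j \<ge> f i + h j - 1\<close> reduces the sum to D c (\<alpha> r + \<beta> s - 1)
  \<ge> 4 \<delta> c^2. Weights replace sets because a residue class is in general only partly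
  filled.\<close>

lemma fiber_edges:
  fixes f h :: "nat \<Rightarrow> real" and \<delta> :: real and k :: nat
  assumes k: "k \<ge> 3" and f: "\<And>i. 0 \<le> f i" "\<And>i. f i \<le> 1" and h: "\<And>i. 0 \<le> h i" "\<And>i. h i \<le> 1"
    and d: "0 < \<delta>" "\<delta> \<le> 1"
  defines "P \<equiv> 2 ^ k"
  defines "\<alpha> \<equiv> \<lambda>r. 8 / real P * (\<Sum>i | i < P \<and> i mod 8 = r. f i)"
    and "\<beta> \<equiv> \<lambda>s. 8 / real P * (\<Sum>j | j < P \<and> j mod 8 = s. h j)"
  assumes v: "(\<exists>r<8. \<exists>s<8. (r + s) mod 8 = 1 \<and> \<alpha> r > \<delta> \<and> \<beta> s > \<delta>) \<or>
      (\<exists>r<8. \<exists>s<8. (r + s) mod 4 = 0 \<and> \<alpha> r + \<beta> s > 1 + 2 * \<delta>)"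
  shows "(\<Sum>i<P. \<Sum>j<P. real (sqrt_count P (i + j)) * (f i * h j)) \<ge> (real P)\<^sup>2 * \<delta>\<^sup>2 / 64"
proof -
  let ?C = "\<lambda>r. {i. i < P \<and> i mod 8 = r}"
  obtain l where l: "k = 3 + l" using k by (metis le_Suc_ex)
  define c where "c = (2::nat) ^ l"
  have P: "P = 8 * c" by (simp add: P_def l c_def power_add)
  have P0: "real P > 0" by (simp add: P_def)
  have sub: "(\<Sum>i<P. \<Sum>j<P. real (sqrt_count P (i + j)) * (f i * h j)) \<ge> (\<Sum>i\<in>?C r. \<Sum>j\<in>?C s. real (sqrt_count P (i + j)) * (f i * h j))" for r s
  proof -
    have "(\<Sum>i\<in>?C r. \<Sum>j\<in>?C s. real (sqrt_count P (i + j)) * (f i * h j)) \<le> (\<Sum>i\<in>?C r. \<Sum>j<P. real (sqrt_count P (i + j)) * (f i * h j))"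
      using f h by (intro sum_mono sum_mono2) auto
    also have "\<dots> \<le> (\<Sum>i<P. \<Sum>j<P. real (sqrt_count P (i + j)) * (f i * h j))"
      using f h by (intro sum_mono2 sum_nonneg) auto
    finally show ?thesis .
  qed
  have Fa: "(\<Sum>i\<in>?C r. f i) = real c * \<alpha> r" and Hb: "(\<Sum>j\<in>?C r. h j) = real c * \<beta> r" for r
    using P0 by (simp_all add: \<alpha>_def \<beta>_def P)
  from v show ?thesis
  proof (elim disjE exE conjE)
    fix r s assume rs: "r < 8" "s < 8" "(r + s) mod 8 = 1" "\<delta> < \<alpha> r" "\<delta> < \<beta> s"
    have "(real P)\<^sup>2 * \<delta>\<^sup>2 / 64 = (real c * \<delta>) * (real c * \<delta>)" by (simp add: P power2_eq_square)
    also have "\<dots> \<le> (real c * \<alpha> r) * (real c * \<beta> s)" using rs d by (intro mult_mono mult_left_mono) auto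
    also have "\<dots> = (\<Sum>i\<in>?C r. \<Sum>j\<in>?C s. f i * h j)" unfolding Fa[symmetric] Hb[symmetric] by (simp add: sum_product)
    also have "\<dots> \<le> (\<Sum>i\<in>?C r. \<Sum>j\<in>?C s. real (sqrt_count P (i + j)) * (f i * h j))"
    proof (intro sum_mono)
      fix i j assume "i \<in> ?C r" "j \<in> ?C s"
      then have "(i + j) mod 8 = 1" using rs(3) by (metis (mono_tags, lifting) mem_Collect_eq mod_add_eq)
      then have "1 \<le> real (sqrt_count P (i + j))" using sqrt_count_two_power_pos[OF _ k] unfolding P_def by simp
      then have "1 * (f i * h j) \<le> real (sqrt_count P (i + j)) * (f i * h j)" using f h by (intro mult_right_mono) auto
      then show "f i * h j \<le> real (sqrt_count P (i + j)) * (f i * h j)" by simp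
    qed
    also note sub
    finally show ?thesis .
  next
    fix r s assume rs: "r < 8" "s < 8" "(r + s) mod 4 = 0" "1 + 2 * \<delta> < \<alpha> r + \<beta> s"
    define D where "D = card {m. m < P \<and> m\<^sup>2 mod 8 = (r + s) mod 8}"
    have P8: "8 dvd P" "P > 0" by (auto simp: P c_def)
    have D: "real D \<ge> 2 * real c" using card_even_roots_mod8[OF rs(3), of c] unfolding D_def P by linarith
    have row: "(\<Sum>j\<in>?C s. sqrt_count P (i + j)) = D" if "i \<in> ?C r" for i
    proof -
      have "(i + s) mod 8 = (r + s) mod 8" using that by (auto simp: mod_simps)
      then show ?thesis using sum_sqrt_count_class[OF P8 rs(2), of i] by (simp add: D_def)
    qed
    have col: "(\<Sum>i\<in>?C r. sqrt_count P (i + j)) = D" if "j \<in> ?C s" for j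
    proof -
      have "(j + r) mod 8 = (j mod 8 + r) mod 8" by (simp add: mod_simps)
      then have "(j + r) mod 8 = (r + s) mod 8" using that by (simp add: add.commute)
      then show ?thesis using sum_sqrt_count_class[OF P8 rs(1), of j] by (simp add: D_def add.commute)
    qed
    have cardC: "card (?C r) = c" using card_residue_class_lessThan[OF rs(1), of c] by (simp add: P)
    have 1: "(\<Sum>i\<in>?C r. \<Sum>j\<in>?C s. real (sqrt_count P (i + j)) * f i) = real D * (\<Sum>i\<in>?C r. f i)"
      unfolding sum_distrib_left by (intro sum.cong refl) (simp add: row[symmetric] sum_distrib_right)
    have 2: "(\<Sum>i\<in>?C r. \<Sum>j\<in>?C s. real (sqrt_count P (i + j)) * h j) = real D * (\<Sum>j\<in>?C s. h j)"
      unfolding sum_distrib_left by (subst sum.swap, intro sum.cong refl) (simp add: col[symmetric] sum_distrib_right)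
    have 3: "(\<Sum>i\<in>?C r. \<Sum>j\<in>?C s. real (sqrt_count P (i + j))) = real D * real c"
    proof -
      have "(\<Sum>i\<in>?C r. \<Sum>j\<in>?C s. real (sqrt_count P (i + j))) = (\<Sum>i\<in>?C r. real D)"
        by (intro sum.cong refl) (simp only: of_nat_sum[symmetric] row)
      then show ?thesis by (simp add: cardC)
    qed
    have "(real P)\<^sup>2 * \<delta>\<^sup>2 / 64 = (real c)\<^sup>2 * (\<delta> * \<delta>)" by (simp add: P power2_eq_square)
    also have "\<dots> \<le> (real c)\<^sup>2 * (4 * \<delta>)" using d by (intro mult_left_mono mult_right_mono) auto
    also have "\<dots> = (2 * real c) * (real c * (2 * \<delta>))" by (simp add: power2_eq_square)
    also have "\<dots> \<le> real D * (real c * (\<alpha> r + \<beta> s - 1))" using D rs(4) d by (intro mult_mono) auto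
    also have "\<dots> = real D * (\<Sum>i\<in>?C r. f i) + real D * (\<Sum>j\<in>?C s. h j) - real D * real c" unfolding Fa Hb by (simp add: algebra_simps)
    also have "\<dots> = (\<Sum>i\<in>?C r. \<Sum>j\<in>?C s. real (sqrt_count P (i + j)) * (f i + h j - 1))"
      unfolding 1[symmetric] 2[symmetric] 3[symmetric] by (simp add: sum.distrib sum_subtractf algebra_simps)
    also have "\<dots> \<le> (\<Sum>i\<in>?C r. \<Sum>j\<in>?C s. real (sqrt_count P (i + j)) * (f i * h j))"
    proof (intro sum_mono mult_left_mono)
      fix i j
      have "0 \<le> (1 - f i) * (1 - h j)" using f h by simp
      then show "f i + h j - 1 \<le> f i * h j" by (simp add: algebra_simps)
    qed simp
    also note sub
    finally show ?thesis .
  qed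
qed

section \<open>Combining the 2-adic fibres with the odd modulus\<close>

lemma sum_fibers:
  fixes g :: "'b \<Rightarrow> real"
  assumes "finite A" "finite Y" "\<phi> ` A \<subseteq> Y"
  shows "(\<Sum>a\<in>A. g (\<phi> a)) = (\<Sum>y\<in>Y. real (card {a\<in>A. \<phi> a = y}) * g y)"
proof -
  have "(\<Sum>a\<in>A. g (\<phi> a)) = (\<Sum>y\<in>Y. \<Sum>a\<in>{a\<in>A. \<phi> a = y}. g (\<phi> a))"
    by (rule sum.group[symmetric]) (use assms in auto)
  then show ?thesis by simp
qed

text \<open>By the Chinese remainder theorem root counts modulo 2^k q dominate products of root
  counts, so the sum splits into edges modulo \<open>q\<close>, each weighted by the edge count
  \<open>E\<close> between two 2-adic fibres. \<open>violating_edges\<close> gives many edges over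
  violating pairs, and \<open>fiber_edges\<close> makes \<open>E\<close> large there.\<close>

lemma main_term_bound:
  fixes A B :: "nat set" and N k q :: nat and \<epsilon> :: real
  assumes k: "k \<ge> 3" and q: "odd q" and eps: "0 < \<epsilon>" "\<epsilon> \<le> 5/8"
    and N: "real N \<ge> 8 * real (2 ^ k * q) / \<epsilon>"
    and A: "A \<subseteq> {1..N}" "real (card A) \<ge> (3/8 + \<epsilon>) * real N" and B: "B \<subseteq> {1..N}" "real (card B) \<ge> (3/8 + \<epsilon>) * real N"
  shows "(\<Sum>a\<in>A. \<Sum>b\<in>B. real (sqrt_count (2 ^ k * q) (a + b))) \<ge> \<epsilon>^3 / 51200 * (real N)\<^sup>2"
proof -
  define P where "P = (2::nat) ^ k"
  define Q where "Q = P * q"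
  have pos: "P > 0" "q > 0" "Q > 0" using q by (auto simp: P_def Q_def odd_pos)
  have cop: "coprime P q" using q by (simp add: P_def)
  have P8: "P = 8 * (P div 8)"
  proof -
    have "(2::nat) ^ 3 dvd 2 ^ k" using k by (rule le_imp_power_dvd)
    then show ?thesis by (simp add: P_def)
  qed
  \<comment> \<open>The number of blocks of length \<open>Q\<close> that cover 0, ..., N, and so the
    capacity of a residue class; dividing by it gives densities at most 1.\<close>
  define R where "R = real (N div Q + 1)"
  have R0: "R > 0" by (simp add: R_def)
  have RQ: "R * Q \<ge> N" "R * Q \<le> N + Q"
  proof -
    have "N < (N div Q + 1) * Q" using pos by (simp add: dividend_less_div_times)
    then have "real N \<le> real ((N div Q + 1) * Q)" by (simp only: of_nat_le_iff less_imp_le)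
    then show "R * Q \<ge> N" by (simp only: R_def of_nat_mult)
    have "(N div Q + 1) * Q \<le> N + Q" by simp
    then have "real ((N div Q + 1) * Q) \<le> real (N + Q)" by (simp only: of_nat_le_iff)
    then show "R * Q \<le> N + Q" by (simp only: R_def of_nat_mult of_nat_add)
  qed
  define \<phi> where "\<phi> a = (a mod P, a mod q)" for a :: nat
  define ct where "ct U i u = real (card {a\<in>U. \<phi> a = (i, u)})" for U i u
  define F where "F U i u = ct U i u / R" for U i u
  define \<alpha> where "\<alpha> U r u = 8 / real P * (\<Sum>i | i < P \<and> i mod 8 = r. F U i u)" for U r u
  have ct_le: "ct U i u \<le> R" if "U \<subseteq> {1..N}" for U i u
  proof -
    have "card {a\<in>U. \<phi> a = (i, u)} \<le> card {..N div Q}"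
    proof (rule card_inj_on_le)
      show "inj_on (\<lambda>a. a div Q) {a\<in>U. \<phi> a = (i, u)}"
      proof (rule inj_onI)
        fix a b assume ab: "a \<in> {a\<in>U. \<phi> a = (i, u)}" "b \<in> {a\<in>U. \<phi> a = (i, u)}" "a div Q = b div Q"
        then have "[a = b] (mod P)" "[a = b] (mod q)" by (auto simp: \<phi>_def cong_def)
        then have "[a = b] (mod Q)" unfolding Q_def using cop by (simp add: coprime_cong_mult_nat)
        then show "a = b" using ab(3) by (metis cong_def div_mult_mod_eq)
      qed
      show "(\<lambda>a. a div Q) ` {a\<in>U. \<phi> a = (i, u)} \<subseteq> {..N div Q}" using that by (auto intro!: div_le_mono)
    qed simp
    then show ?thesis by (simp add: ct_def R_def)
  qed
  have F01: "0 \<le> F U i u" "F U i u \<le> 1" if "U \<subseteq> {1..N}" for U i u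
    using ct_le[OF that, of i u] R0 by (auto simp: F_def ct_def)
  have \<alpha>1: "\<alpha> U r u \<le> 1" if "U \<subseteq> {1..N}" "r < 8" for U r u
  proof -
    have "(\<Sum>i | i < P \<and> i mod 8 = r. F U i u) \<le> real (card {i. i < P \<and> i mod 8 = r}) * 1"
      by (rule sum_bounded_above) (use F01 that in auto)
    also have "card {i. i < P \<and> i mod 8 = r} = P div 8"
      using card_residue_class_lessThan[OF that(2), of "P div 8"] P8 by simp
    also have "real (P div 8) = real P / 8" using P8 by (metis of_nat_mult of_nat_numeral nonzero_mult_div_cancel_left zero_neq_numeral)
    finally show ?thesis using pos unfolding \<alpha>_def by (simp add: field_simps)
  qed
  have fib: "(\<Sum>a\<in>U. g (a mod P) (a mod q)) = R * (\<Sum>u<q. \<Sum>i<P. F U i u * g i u)" if "U \<subseteq> {1..N}" for U and g :: "nat \<Rightarrow> nat \<Rightarrow> real"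
  proof -
    have fin: "finite U" using that finite_subset by blast
    have "(\<Sum>a\<in>U. g (a mod P) (a mod q)) = (\<Sum>a\<in>U. (case_prod g) (\<phi> a))" by (simp add: \<phi>_def)
    also have "\<dots> = (\<Sum>y\<in>{..<P} \<times> {..<q}. real (card {a\<in>U. \<phi> a = y}) * case_prod g y)"
      by (rule sum_fibers[OF fin]) (use pos in \<open>auto simp: \<phi>_def\<close>)
    also have "\<dots> = (\<Sum>i<P. \<Sum>u<q. ct U i u * g i u)"
      unfolding sum.cartesian_product ct_def by (simp add: case_prod_unfold)
    also have "\<dots> = (\<Sum>u<q. \<Sum>i<P. ct U i u * g i u)" by (rule sum.swap)
    also have "\<dots> = R * (\<Sum>u<q. \<Sum>i<P. F U i u * g i u)" using R0 by (simp add: sum_distrib_left F_def)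
    finally show ?thesis .
  qed
  have mean: "(\<Sum>u<q. \<Sum>r<8. \<alpha> U r u) \<ge> (3 + 7 * \<epsilon>) * q" if U: "U \<subseteq> {1..N}" "real (card U) \<ge> (3/8 + \<epsilon>) * real N" for U
  proof -
    have "(\<Sum>r<8. \<alpha> U r u) = 8 / real P * (\<Sum>i<P. F U i u)" for u
    proof -
      have "(\<Sum>r<8. \<Sum>i | i < P \<and> i mod 8 = r. F U i u) = (\<Sum>r<8. \<Sum>i\<in>{i\<in>{..<P}. i mod 8 = r}. F U i u)"
        by (intro sum.cong refl) auto
      also have "\<dots> = (\<Sum>i<P. F U i u)" by (rule sum.group) auto
      finally have eq: "(\<Sum>r<8. \<Sum>i | i < P \<and> i mod 8 = r. F U i u) = (\<Sum>i<P. F U i u)" .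
      have "(\<Sum>r<8. \<alpha> U r u) = 8 / real P * (\<Sum>r<8. \<Sum>i | i < P \<and> i mod 8 = r. F U i u)"
        unfolding \<alpha>_def by (rule sum_distrib_left[symmetric])
      then show ?thesis by (simp only: eq)
    qed
    then have "(\<Sum>u<q. \<Sum>r<8. \<alpha> U r u) = 8 / real P * (\<Sum>u<q. \<Sum>i<P. F U i u)" by (simp add: sum_distrib_left)
    moreover have "real (card U) = R * (\<Sum>u<q. \<Sum>i<P. F U i u)" using fib[OF U(1), of "\<lambda>_ _. 1"] by simp
    ultimately have eq: "(\<Sum>u<q. \<Sum>r<8. \<alpha> U r u) = 8 * real (card U) / (real P * R)" using R0 by simp
    \<comment> \<open>The last, incomplete block costs at most 8Q \<le> \<epsilon>N, the step from
      8\<epsilon> to 7\<epsilon>.\<close>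
    have "(3 + 7 * \<epsilon>) * (R * Q) \<le> (3 + 7 * \<epsilon>) * (real N + real Q)" using RQ eps by (intro mult_left_mono) auto
    also have "\<dots> \<le> 8 * real (card U)"
    proof -
      have "8 * real Q \<le> \<epsilon> * real N" using N eps by (simp add: Q_def P_def field_simps)
      moreover have "(3 + 7 * \<epsilon>) * real Q \<le> 8 * real Q" using eps by (intro mult_right_mono) auto
      ultimately show ?thesis using U(2) by (simp add: algebra_simps)
    qed
    finally have "((3 + 7 * \<epsilon>) * q) * (real P * R) \<le> 8 * real (card U)" by (simp add: Q_def mult_ac)
    then show ?thesis unfolding eq using pos R0 by (simp add: pos_le_divide_eq)
  qed
  define \<delta> where "\<delta> = \<epsilon> / 4"
  have d: "0 < \<delta>" "\<delta> \<le> 1" using eps by (auto simp: \<delta>_def)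
  define E where "E u v = (\<Sum>i<P. \<Sum>j<P. real (sqrt_count P (i + j)) * (F A i u * F B j v))" for u v
  define Vi where "Vi = violating \<delta> q (\<alpha> A) (\<alpha> B)"
  have Evi: "E u v \<ge> (real P)\<^sup>2 * \<delta>\<^sup>2 / 64" if "(u, v) \<in> Vi" for u v
    unfolding E_def P_def
    by (rule fiber_edges[OF k]) (use F01 A(1) B(1) d that in \<open>auto simp: Vi_def violating_def \<alpha>_def P_def\<close>)
  have E0: "E u v \<ge> 0" for u v unfolding E_def using F01 A(1) B(1) by (intro sum_nonneg) auto
  have "(\<Sum>a\<in>A. \<Sum>b\<in>B. real (sqrt_count (2 ^ k * q) (a + b))) \<ge> (\<Sum>a\<in>A. \<Sum>b\<in>B. real (sqrt_count P (a mod P + b mod P)) * real (sqrt_count q (a mod q + b mod q)))"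
  proof (intro sum_mono)
    fix a b
    have "sqrt_count P (a mod P + b mod P) = sqrt_count P (a + b)" "sqrt_count q (a mod q + b mod q) = sqrt_count q (a + b)"
      by (metis mod_add_eq sqrt_count_mod)+
    then show "real (sqrt_count P (a mod P + b mod P)) * real (sqrt_count q (a mod q + b mod q)) \<le> real (sqrt_count (2 ^ k * q) (a + b))"
      using sqrt_count_mult[OF cop pos(1,2), of "a + b"] unfolding P_def[symmetric] of_nat_mult[symmetric] of_nat_le_iff by simp
  qed
  also have "(\<Sum>a\<in>A. \<Sum>b\<in>B. real (sqrt_count P (a mod P + b mod P)) * real (sqrt_count q (a mod q + b mod q)))
    = R\<^sup>2 * (\<Sum>u<q. \<Sum>v<q. real (sqrt_count q (u + v)) * E u v)"
  proof -
    have "(\<Sum>a\<in>A. \<Sum>b\<in>B. real (sqrt_count P (a mod P + b mod P)) * real (sqrt_count q (a mod q + b mod q)))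
      = (\<Sum>a\<in>A. R * (\<Sum>v<q. \<Sum>j<P. F B j v * (real (sqrt_count P (a mod P + j)) * real (sqrt_count q (a mod q + v)))))"
      by (intro sum.cong refl fib[OF B(1), of "\<lambda>j v. real (sqrt_count P (_ mod P + j)) * real (sqrt_count q (_ mod q + v))"])
    also have "\<dots> = R * (\<Sum>u<q. \<Sum>i<P. F A i u * (R * (\<Sum>v<q. \<Sum>j<P. F B j v * (real (sqrt_count P (i + j)) * real (sqrt_count q (u + v))))))"
      by (rule fib[OF A(1), of "\<lambda>i u. R * (\<Sum>v<q. \<Sum>j<P. F B j v * (real (sqrt_count P (i + j)) * real (sqrt_count q (u + v))))"])
    also have "\<dots> = R\<^sup>2 * (\<Sum>u<q. \<Sum>i<P. \<Sum>v<q. \<Sum>j<P. real (sqrt_count q (u + v)) * (real (sqrt_count P (i + j)) * (F A i u * F B j v)))"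
      unfolding sum_distrib_left by (intro sum.cong refl) (simp add: power2_eq_square mult_ac)
    also have "(\<Sum>u<q. \<Sum>i<P. \<Sum>v<q. \<Sum>j<P. real (sqrt_count q (u + v)) * (real (sqrt_count P (i + j)) * (F A i u * F B j v)))
      = (\<Sum>u<q. \<Sum>v<q. \<Sum>i<P. \<Sum>j<P. real (sqrt_count q (u + v)) * (real (sqrt_count P (i + j)) * (F A i u * F B j v)))"
      by (rule sum.cong[OF refl], rule sum.swap)
    finally show ?thesis unfolding E_def sum_distrib_left .
  qed
  finally have lower: "(\<Sum>a\<in>A. \<Sum>b\<in>B. real (sqrt_count (2 ^ k * q) (a + b))) \<ge> R\<^sup>2 * (\<Sum>u<q. \<Sum>v<q. real (sqrt_count q (u + v)) * E u v)" .
  have "(\<Sum>u<q. \<Sum>v<q. real (sqrt_count q (u + v)) * E u v) \<ge> (real P)\<^sup>2 * \<delta>\<^sup>2 / 64 * (\<epsilon> / 50 * (real q)\<^sup>2)"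
  proof -
    have "(real P)\<^sup>2 * \<delta>\<^sup>2 / 64 * (\<epsilon> / 50 * (real q)\<^sup>2) \<le> (real P)\<^sup>2 * \<delta>\<^sup>2 / 64 * (\<Sum>(u, v)\<in>Vi. real (sqrt_count q (u + v)))"
      unfolding Vi_def \<delta>_def
      by (intro mult_left_mono violating_edges[OF q eps]) (use \<alpha>1 mean A B in auto)
    also have "\<dots> = (\<Sum>(u, v)\<in>Vi. real (sqrt_count q (u + v)) * ((real P)\<^sup>2 * \<delta>\<^sup>2 / 64))"
      by (simp add: sum_distrib_left case_prod_unfold mult_ac)
    also have "\<dots> \<le> (\<Sum>(u, v)\<in>Vi. real (sqrt_count q (u + v)) * E u v)"
    proof (rule sum_mono)
      fix z assume z: "z \<in> Vi"
      obtain u v where uv: "z = (u, v)" by (metis surj_pair)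
      have "E u v \<ge> (real P)\<^sup>2 * \<delta>\<^sup>2 / 64" using Evi z uv by simp
      from mult_left_mono[OF this, of "real (sqrt_count q (u + v))"]
      show "(case z of (u, v) \<Rightarrow> real (sqrt_count q (u + v)) * ((real P)\<^sup>2 * \<delta>\<^sup>2 / 64)) \<le> (case z of (u, v) \<Rightarrow> real (sqrt_count q (u + v)) * E u v)"
        by (simp add: uv)
    qed
    also have "\<dots> \<le> (\<Sum>(u, v)\<in>{..<q} \<times> {..<q}. real (sqrt_count q (u + v)) * E u v)"
      using E0 by (intro sum_mono2) (auto simp: Vi_def violating_def)
    finally show ?thesis unfolding sum.cartesian_product .
  qed
  from mult_left_mono[OF this zero_le_power2[of R]] lower
  have "(\<Sum>a\<in>A. \<Sum>b\<in>B. real (sqrt_count (2 ^ k * q) (a + b))) \<ge> R\<^sup>2 * ((real P)\<^sup>2 * \<delta>\<^sup>2 / 64 * (\<epsilon> / 50 * (real q)\<^sup>2))"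
    by linarith
  \<comment> \<open>51200 = 64 * 16 * 50, with 16 from \<delta> = \<epsilon>/4.\<close>
  moreover have "R\<^sup>2 * ((real P)\<^sup>2 * \<delta>\<^sup>2 / 64 * (\<epsilon> / 50 * (real q)\<^sup>2)) = \<epsilon>^3 / 51200 * (R * Q)\<^sup>2"
    by (simp add: \<delta>_def Q_def power2_eq_square power3_eq_cube)
  moreover have "\<epsilon>^3 / 51200 * (R * Q)\<^sup>2 \<ge> \<epsilon>^3 / 51200 * (real N)\<^sup>2"
    using RQ eps by (intro mult_left_mono power_mono) auto
  ultimately show ?thesis by linarith
qed

section \<open>Choice of parameters and conclusion\<close>

theorem theorem1p1:
  "\<forall>\<epsilon>::real. \<epsilon> > 0 \<longrightarrow> (\<exists>N0::nat. \<forall>N::nat. N \<ge> N0 \<longrightarrow>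
     (\<forall>A B :: nat set. A \<subseteq> {1..N} \<longrightarrow> B \<subseteq> {1..N} \<longrightarrow>
        real (card A) \<ge> (3/8 + \<epsilon>) * real N \<longrightarrow> real (card B) \<ge> (3/8 + \<epsilon>) * real N \<longrightarrow>
        (\<exists>a\<in>A. \<exists>b\<in>B. a + b \<in> pos_squares) \<and>
        real (card {(a, b) \<in> A \<times> B. a + b \<in> pos_squares}) \<ge> 10 powr (-6) * \<epsilon>^3 * real N powr (3/2)))"
proof (intro allI impI)
  fix \<epsilon> :: real assume e0: "\<epsilon> > 0"
  show "\<exists>N0::nat. \<forall>N::nat. N \<ge> N0 \<longrightarrow>
     (\<forall>A B :: nat set. A \<subseteq> {1..N} \<longrightarrow> B \<subseteq> {1..N} \<longrightarrow>
        real (card A) \<ge> (3/8 + \<epsilon>) * real N \<longrightarrow> real (card B) \<ge> (3/8 + \<epsilon>) * real N \<longrightarrow>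
        (\<exists>a\<in>A. \<exists>b\<in>B. a + b \<in> pos_squares) \<and>
        real (card {(a, b) \<in> A \<times> B. a + b \<in> pos_squares}) \<ge> 10 powr (-6) * \<epsilon>^3 * real N powr (3/2))"
  proof (cases "\<epsilon> \<le> 5/8")
    case False
    \<comment> \<open>The density hypothesis asks for more than N elements, so the claim is vacuous
      for N \<ge> 1.\<close>
    have "\<not> real (card A) \<ge> (3/8 + \<epsilon>) * real N" if "N \<ge> 1" "A \<subseteq> {1..N}" for N A
    proof -
      have "card A \<le> N" using card_mono[OF _ that(2)] by simp
      moreover have "1 * real N < (3/8 + \<epsilon>) * real N" using False that(1) by (intro mult_strict_right_mono) auto
      ultimately show ?thesis by simp
    qed
    then show ?thesis by blast
  next
    case True
    \<comment> \<open>The main term will be \<epsilon>^3/204800 and the error 2\<eta>; since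
      1/204800 > 3/10^6, at least \<epsilon>^3/10^6 remains.\<close>
    define \<eta> where "\<eta> = \<epsilon>^3 / 10^6"
    have e3: "\<epsilon>^3 > 0" using e0 by simp
    have eta: "\<eta> > 0" "\<eta> \<le> 1"
    proof -
      have "\<epsilon>^3 \<le> 1^3" using True e0 by (intro power_mono) auto
      then show "\<eta> > 0" "\<eta> \<le> 1" using e3 by (auto simp: \<eta>_def)
    qed
    obtain C :: nat where C: "\<And>Q. Q > 0 \<Longrightarrow> (\<forall>q\<in>{1..C}. q dvd Q) \<Longrightarrow> (\<exists>N0::nat. \<forall>N\<ge>N0. \<forall>A B. A \<subseteq> {1..N} \<longrightarrow> B \<subseteq> {1..N} \<longrightarrow>
      real (card {(a, b) \<in> A \<times> B. a + b \<in> pos_squares}) \<ge>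
      (\<Sum>a\<in>A. \<Sum>b\<in>B. real (sqrt_count Q (a + b))) / (4 * sqrt N) - 2 * \<eta> * real N * sqrt N)"
      using transference[OF eta] by blast
    obtain j q where jq: "fact C = 2 ^ j * q" "odd (q::nat)"
    proof -
      have "(fact C :: nat) \<noteq> 0" "\<not> is_unit (2::nat)" by simp_all
      from multiplicity_decompose'[OF this] show thesis using that by blast
    qed
    \<comment> \<open>This is 8 times C factorial; the extra 8 guarantees the exponent of 2 is at
      least 3 even when \<open>C\<close> is small.\<close>
    define Q where "Q = 2 ^ (j + 3) * q"
    have Q0: "Q > 0" using jq(2) by (simp add: Q_def odd_pos)
    have Qd: "\<forall>d\<in>{1..C}. d dvd Q"
    proof
      fix d assume "d \<in> {1..C}"
      then have "d dvd fact C" by (auto intro: dvd_fact)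
      also have "fact C dvd Q" by (simp add: jq(1) Q_def power_add)
      finally show "d dvd Q" .
    qed
    obtain N1 :: nat where N1: "\<And>N A B. N \<ge> N1 \<Longrightarrow> A \<subseteq> {1..N} \<Longrightarrow> B \<subseteq> {1..N} \<Longrightarrow>
      real (card {(a, b) \<in> A \<times> B. a + b \<in> pos_squares}) \<ge>
      (\<Sum>a\<in>A. \<Sum>b\<in>B. real (sqrt_count Q (a + b))) / (4 * sqrt N) - 2 * \<eta> * real N * sqrt N"
      using C[OF Q0 Qd] by blast
    define N0 where "N0 = max N1 (max 1 (nat \<lceil>8 * real Q / \<epsilon>\<rceil>))"
    have "(\<exists>a\<in>A. \<exists>b\<in>B. a + b \<in> pos_squares) \<and>
        real (card {(a, b) \<in> A \<times> B. a + b \<in> pos_squares}) \<ge> 10 powr (-6) * \<epsilon>^3 * real N powr (3/2)"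
      if N: "N \<ge> N0" and A: "A \<subseteq> {1..N}" "real (card A) \<ge> (3/8 + \<epsilon>) * real N" and B: "B \<subseteq> {1..N}" "real (card B) \<ge> (3/8 + \<epsilon>) * real N" for N A B
    proof -
      have N': "N \<ge> N1" "N \<ge> 1" "real N \<ge> 8 * real Q / \<epsilon>" using N unfolding N0_def by linarith+
      define s where "s = sqrt N"
      have s: "s > 0" "s * s = real N" using N'(2) by (auto simp: s_def)
      have "(\<Sum>a\<in>A. \<Sum>b\<in>B. real (sqrt_count Q (a + b))) \<ge> \<epsilon>^3 / 51200 * (real N)\<^sup>2"
        unfolding Q_def by (rule main_term_bound[OF _ jq(2) e0 True _ A B]) (use N'(3) in \<open>auto simp: Q_def\<close>)
      then have "(\<Sum>a\<in>A. \<Sum>b\<in>B. real (sqrt_count Q (a + b))) / (4 * s) \<ge> \<epsilon>^3 / 51200 * (real N)\<^sup>2 / (4 * s)"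
        using s by (intro divide_right_mono) auto
      moreover have "\<epsilon>^3 / 51200 * (real N)\<^sup>2 / (4 * s) = \<epsilon>^3 / 204800 * (real N * s)"
        using s by (simp add: power2_eq_square field_simps)
      ultimately have "real (card {(a, b) \<in> A \<times> B. a + b \<in> pos_squares}) \<ge> \<epsilon>^3 / 204800 * (real N * s) - 2 * \<eta> * real N * s"
        using N1[OF N'(1) A(1) B(1)] unfolding s_def by linarith
      moreover have "\<epsilon>^3 / 204800 * (real N * s) - 2 * \<eta> * real N * s \<ge> \<epsilon>^3 / 10^6 * (real N * s)"
      proof -
        define w where "w = \<epsilon>^3 * (real N * s)"
        have "0 \<le> w" using e3 s by (simp add: w_def)
        moreover have "\<epsilon>^3 / 204800 * (real N * s) = w / 204800" "2 * \<eta> * real N * s = 2 * w / 10^6" "\<epsilon>^3 / 10^6 * (real N * s) = w / 10^6"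
          by (simp_all add: w_def \<eta>_def)
        ultimately show ?thesis by simp
      qed
      moreover have "10 powr (-6) * \<epsilon>^3 * real N powr (3/2) = \<epsilon>^3 / 10^6 * (real N * s)"
      proof -
        have "real N powr (3/2) = real N powr (1 + 1/2)" by simp
        also have "\<dots> = real N * s" unfolding powr_add using N'(2) by (simp add: s_def powr_half_sqrt)
        finally have 1: "real N powr (3/2) = real N * s" .
        have 2: "10 powr (-6) = 1 / (10::real)^6" by (rule powr_neg_numeral) simp
        show ?thesis unfolding 1 2 by simp
      qed
      ultimately have bound: "real (card {(a, b) \<in> A \<times> B. a + b \<in> pos_squares}) \<ge> 10 powr (-6) * \<epsilon>^3 * real N powr (3/2)" by linarith
      moreover have "10 powr (-6) * \<epsilon>^3 * real N powr (3/2) > 0"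
      proof (intro mult_pos_pos e3)
        show "10 powr (-6) > (0::real)" by (simp only: powr_gt_zero)
        show "real N powr (3/2) > 0" using N'(2) by simp
      qed
      ultimately have "card {(a, b) \<in> A \<times> B. a + b \<in> pos_squares} \<noteq> 0" by linarith
      then have "{(a, b) \<in> A \<times> B. a + b \<in> pos_squares} \<noteq> {}" by (metis card.empty)
      then show ?thesis using bound by blast
    qed
    then show ?thesis by blast
  qed
qed

end
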